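(* Let $(\mathcal X,d,\mu)$ be a doubling metric measure space with doubling exponent $n>0$ (see context). Suppose that $\mathcal X$ supports a weak $(1,p)$-Poincaré inequality with $p\in(1,\infty)$. Let $s\in(1,\infty)$. Then for every $q\in(0,\infty]$, $\dot M^s_{np/(n+ps-p),\,q}(\mathcal X)$ is trivial, and for every $q\in(0,\,np/(n+ps-p)]$, $\dot N^s_{np/(n+ps-p),\,q}(\mathcal X)$ is trivial. Moreover, if either $\mathcal X$ is complete or $\mathcal X$ supports a weak $(1,p-\epsilon)$-Poincaré inequality for some $\epsilon\in(0,p-1)$, then for every $q\in(np/(n+ps-p),\,\infty]$, $\dot N^s_{np/(n+ps-p),\,q}(\mathcal X)$ is trivial. (Trivial means containing only constant functions, up to equality almost everywhere.)
   Context: Setting: $(\mathcal X,d)$ is a metric space and $\mu$ a regular Borel measure on $\mathcal X$ such that all balls have finite and positive measure, and $\mu$ is doubling: there exist constants $C_1>1$ and $n>0$ (fixed; $n$ is called the doubling exponent here) such that $\mu(B(x,\lambda r))\le C_1\lambda^n\mu(B(x,r))$ for all $x\in\mathcal X$, $r\in(0,\infty)$, $\lambda\in(1,\infty)$. Functions are real-valued; $⨍_E f\,d\mu=\frac1{\mu(E)}\int_E f\,d\mu$, $u_B=⨍_Bu\,d\mu$. Poincaré inequality: a nonnegative Borel function $g$ is a $p$-weak upper gradient of $u$ if $|u(x)-u(y)|\le\int_\gamma g\,ds$ for all $\gamma\in\Gamma_{\rm rect}\setminus\Gamma$, where $x,y$ are the endpoints of $\gamma$, $\Gamma_{\rm rect}$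 is the collection of non-constant compact rectifiable curves in $\mathcal X$, and $\Gamma$ is some family of curves of $p$-modulus zero. $\mathcal X$ supports a weak $(1,p)$-Poincaré inequality, $p\in[1,\infty)$, if there exist $C>0$ and $\lambda>1$ such that for all functions $u$ that are integrable on balls, all $p$-weak upper gradients $g$ of $u$ and all balls $B$ of radius $r>0$, $⨍_B|u-u_B|\,d\mu\le Cr\{⨍_{\lambda B}g^p\,d\mu\}^{1/p}$. Fractional $s$-Hajłasz gradient ($s\in(0,\infty)$): for a measurable function $u$, a sequence $\vec g=\{g_k\}_{k\in\mathbb Z}$ of nonnegative measurable functions belongs to $\mathbb D^s(u)$ if there is $E\subset\mathcal X$ with $\mu(E)=0$ such that for all $k\in\mathbb Z$ and all $x,y\in\mathcal X\setminus E$ with $2^{-k-1}\le d(x,y)<2^{-k}$, $|u(x)-u(y)|\le[d(x,y)]^s[g_k(x)+g_k(y)]$. For $\tau\in(0,\infty)$, $q\in(0,\infty]$: $\dot N^s_{\tau,q}(\mathcal X)$ is the space of all measurable $u$ with $\inf_{\vec g\in\mathbb D^s(u)}\big\|\{\|g_k\|_{L^\tau(\mathcal X)}\}_{k\in\mathbb Z}\big\|_{\ell^q}<\infty$, and $\dot M^s_{\tau,q}(\mathcal X)$ is the space of all measurable $u$ with $\inf_{\vec g\in\mathbb D^s(u)}\big\|\,\|\{g_k\}_{k\in\mathbb Z}\|_{\ell^q}\big\|_{L^\tau(\mathcal X)}<\infty$ (with $\ell^\infty$ meaning supremum over $k$). *)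

theory Defs
  imports "HOL-Analysis.Analysis"
begin

text \<open>
  The metric space is a type of class \<^class>\<open>metric_space\<close>; its measure \<open>M\<close> is
  Borel regular: every Borel set is measurable, and every measurable set is contained in a Borel
  set of the same measure.  So \<open>sets M\<close> may be the Borel sets, but also
  their \<open>M\<close>-completion.
\<close>

definition borel_regular :: "'a::metric_space measure \<Rightarrow> bool" where
  "borel_regular M \<longleftrightarrow>
     space M = UNIV \<and> sets borel \<subseteq> sets M \<and>
     (\<forall>A\<in>sets M. \<exists>B\<in>sets borel. A \<subseteq> B \<and> emeasure M B = emeasure M A)"

definition doubling_metric_measure_space ::
    "'a::metric_space measure \<Rightarrow> real \<Rightarrow> real \<Rightarrow> bool" where
  "doubling_metric_measure_space M C\<^sub>1 n \<longleftrightarrow>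
     borel_regular M \<and> C\<^sub>1 > 1 \<and> n > 0 \<and>
     (\<forall>x. \<forall>r>0. 0 < emeasure M (ball x r) \<and> emeasure M (ball x r) < \<infinity>) \<and>
     (\<forall>x. \<forall>r>0. \<forall>l>1.
        emeasure M (ball x (l * r)) \<le> ennreal (C\<^sub>1 * l powr n) * emeasure M (ball x r))"

text \<open>Powers of extended nonnegative numbers; only used for exponents \<open>a > 0\<close>.\<close>

definition epowr :: "ennreal \<Rightarrow> real \<Rightarrow> ennreal" where
  "epowr x a = (if x = \<infinity> then \<infinity> else ennreal (enn2real x powr a))"

definition average :: "'a measure \<Rightarrow> 'a set \<Rightarrow> ('a \<Rightarrow> real) \<Rightarrow> real" where
  "average M E f = (LINT x:E|M. f x) / measure M E"

definition average_nn :: "'a measure \<Rightarrow> 'a set \<Rightarrow> ('a \<Rightarrow> ennreal) \<Rightarrow> ennreal" where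
  "average_nn M E f = (\<integral>\<^sup>+x\<in>E. f x \<partial>M) / emeasure M E"

text \<open>
  Curves are parametrized over the unit interval (the library's \<^const>\<open>path\<close>).
  The length of the restriction to \<open>{a..b}\<close> is the supremum of the variation sums over all
  finite increasing lists of points of \<open>{a..b}\<close>.
\<close>

definition curve_length :: "(real \<Rightarrow> 'a::metric_space) \<Rightarrow> real \<Rightarrow> real \<Rightarrow> ennreal" where
  "curve_length \<gamma> a b =
     (SUP ts\<in>{ts. sorted ts \<and> set ts \<subseteq> {a..b}}.
        ennreal (\<Sum>i<length ts - 1. dist (\<gamma> (ts ! i)) (\<gamma> (ts ! Suc i))))"

definition rect_curves :: "(real \<Rightarrow> 'a::metric_space) set" where
  "rect_curves = {\<gamma>. path \<gamma> \<and> curve_length \<gamma> 0 1 < \<infinity> \<and> \<not> \<gamma> constant_on {0..1}}"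

text \<open>
  Arc-length parametrization of a rectifiable curve, defined on \<open>{0..L}\<close> with \<open>L\<close> the length.
  The value does not depend on the chosen parameter, since \<open>\<gamma>\<close> is constant between two
  parameters that are reached after the same length.
\<close>

definition arclength_param :: "(real \<Rightarrow> 'a::metric_space) \<Rightarrow> real \<Rightarrow> 'a" where
  "arclength_param \<gamma> t = \<gamma> (SOME r. r \<in> {0..1} \<and> curve_length \<gamma> 0 r = ennreal t)"

definition curve_integral :: "(real \<Rightarrow> 'a::metric_space) \<Rightarrow> ('a \<Rightarrow> ennreal) \<Rightarrow> ennreal" where
  "curve_integral \<gamma> \<rho> =
     (\<integral>\<^sup>+t\<in>{0..enn2real (curve_length \<gamma> 0 1)}. \<rho> (arclength_param \<gamma> t) \<partial>lborel)"

definition modulus :: "'a::metric_space measure \<Rightarrow> real \<Rightarrow> (real \<Rightarrow> 'a) set \<Rightarrow> ennreal" where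
  "modulus M p \<Gamma> =
     (INF \<rho>\<in>{\<rho> \<in> borel_measurable borel. \<forall>\<gamma>\<in>\<Gamma>. 1 \<le> curve_integral \<gamma> \<rho>}.
        \<integral>\<^sup>+x. epowr (\<rho> x) p \<partial>M)"

definition weak_upper_gradient ::
    "'a::metric_space measure \<Rightarrow> real \<Rightarrow> ('a \<Rightarrow> real) \<Rightarrow> ('a \<Rightarrow> real) \<Rightarrow> bool" where
  "weak_upper_gradient M p u g \<longleftrightarrow>
     g \<in> borel_measurable borel \<and> (\<forall>x. 0 \<le> g x) \<and>
     (\<exists>\<Gamma>\<subseteq>rect_curves. modulus M p \<Gamma> = 0 \<and>
        (\<forall>\<gamma>\<in>rect_curves - \<Gamma>.
           ennreal \<bar>u (pathstart \<gamma>) - u (pathfinish \<gamma>)\<bar>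
             \<le> curve_integral \<gamma> (\<lambda>x. ennreal (g x))))"

definition supports_poincare :: "'a::metric_space measure \<Rightarrow> real \<Rightarrow> bool" where
  "supports_poincare M p \<longleftrightarrow>
     (\<exists>C>0. \<exists>l>1. \<forall>u g.
        (\<forall>x. \<forall>r>0. set_integrable M (ball x r) u) \<longrightarrow> weak_upper_gradient M p u g \<longrightarrow>
        (\<forall>x. \<forall>r>0.
           ennreal (average M (ball x r) (\<lambda>y. \<bar>u y - average M (ball x r) u\<bar>))
             \<le> ennreal (C * r) *
                epowr (average_nn M (ball x (l * r)) (\<lambda>y. ennreal (g y powr p))) (1 / p)))"

definition hajlasz_gradients ::
    "'a::metric_space measure \<Rightarrow> real \<Rightarrow> ('a \<Rightarrow> real) \<Rightarrow> (int \<Rightarrow> 'a \<Rightarrow> real) set" where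
  "hajlasz_gradients M s u =
     {g. (\<forall>k. g k \<in> borel_measurable M \<and> (\<forall>x. 0 \<le> g k x)) \<and>
         (\<exists>E\<in>null_sets M. \<forall>k. \<forall>x\<in>-E. \<forall>y\<in>-E.
            2 powi (- k - 1) \<le> dist x y \<and> dist x y < 2 powi (- k) \<longrightarrow>
            \<bar>u x - u y\<bar> \<le> dist x y powr s * (g k x + g k y))}"

definition L_norm :: "'a measure \<Rightarrow> real \<Rightarrow> ('a \<Rightarrow> ennreal) \<Rightarrow> ennreal" where
  "L_norm M \<tau> f = epowr (\<integral>\<^sup>+x. epowr (f x) \<tau> \<partial>M) (1 / \<tau>)"

definition l_norm :: "ennreal \<Rightarrow> (int \<Rightarrow> ennreal) \<Rightarrow> ennreal" where
  "l_norm q a =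
     (if q = \<infinity> then (SUP k. a k)
      else epowr (\<integral>\<^sup>+k. epowr (a k) (enn2real q) \<partial>count_space UNIV) (1 / enn2real q))"

definition N_space ::
    "'a::metric_space measure \<Rightarrow> real \<Rightarrow> real \<Rightarrow> ennreal \<Rightarrow> ('a \<Rightarrow> real) set" where
  "N_space M s \<tau> q =
     {u \<in> borel_measurable M.
        (INF g\<in>hajlasz_gradients M s u. l_norm q (\<lambda>k. L_norm M \<tau> (\<lambda>x. ennreal (g k x)))) < \<infinity>}"

definition M_space ::
    "'a::metric_space measure \<Rightarrow> real \<Rightarrow> real \<Rightarrow> ennreal \<Rightarrow> ('a \<Rightarrow> real) set" where
  "M_space M s \<tau> q =
     {u \<in> borel_measurable M.
        (INF g\<in>hajlasz_gradients M s u. L_norm M \<tau> (\<lambda>x. l_norm q (\<lambda>k. ennreal (g k x)))) < \<infinity>}"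

definition trivial_space :: "'a measure \<Rightarrow> ('a \<Rightarrow> real) set \<Rightarrow> bool" where
  "trivial_space M S \<longleftrightarrow> (\<forall>u\<in>S. \<exists>c. AE x in M. u x = c)"

end

theory Submission
  imports Defs
begin

text \<open>
  All the spaces in question are contained in \<open>N^s_{\<tau>,\<infinity>}\<close>, and already the weak
  \<open>(1,p)\<close>-Poincare inequality with \<open>p > 1\<close> makes that space trivial; self-improvement of the
  inequality is avoided.  Put \<open>b = 1/\<tau> = 1/p + (s-1)/n\<close> and replace \<open>u\<close> by the bounded
  function \<open>arctan u\<close>.  At each scale \<open>\<rho>\<close> one has
  \<open>|u x - u y| \<le> \<rho>^s (F x^b + F y^b)\<close> for \<open>d(x,y) < \<rho>\<close>, where the integrals of \<open>F = F_\<rho>\<close>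
  are uniformly bounded.  Averaging \<open>u\<close> at scale \<open>\<rho>\<close> over the points where \<open>F\<close> is not much larger
  than its mean gives \<open>v\<close> with an upper gradient \<open>h\<close> comparable to \<open>\<rho>^(s-1) H^b\<close>, where \<open>H\<close> is
  the local mean of \<open>1 + F\<close>.  Since \<open>H \<le> C \<rho>^(-n)\<close> on a fixed ball, there \<open>h\<close> is bounded in \<open>L^p\<close>
  and tends to \<open>0\<close> in \<open>L^1\<close> as \<open>\<rho>\<close> tends to \<open>0\<close>, while \<open>v\<close> tends to \<open>u\<close> in \<open>L^1\<close>.  Because
  \<open>p > 1\<close>, suitable arithmetic means of such \<open>h\<close> tend to \<open>0\<close> in \<open>L^p\<close>, and the Poincare inequality
  for the corresponding means of the functions \<open>v\<close> shows that \<open>u\<close> is constant on every ball.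
\<close>

section \<open>Arc length and upper gradients\<close>

text \<open>The exponent \<open>\<tau>\<close> is critical. If \<open>H \<le> A \<rho>^(-n)\<close>,
  then \<open>\<rho>^((s-1)p) H^(bp)\<close> is at most
  \<open>A^(bp-1) \<rho>^((s-1)p - n(bp-1)) H\<close>, and \<open>b = 1/p + (s-1)/n\<close> is
  exactly the value for which the power of \<open>\<rho>\<close> is 0. Small scales therefore keep
  the energies bounded without making them small, and the Poincare inequality for a single
  approximation gives nothing. In \<open>L^1\<close> there is room: the same count leaves
  \<open>\<rho>^(n(1-1/p))\<close> if \<open>b > 1\<close> and \<open>\<rho>^(s-1)\<close> if
  \<open>b \<le> 1\<close>. The arithmetic means turn this into smallness in \<open>L^p\<close>, as
  an elementary substitute for weak convergence and Mazur's lemma. The other obstacle is that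
  \<open>\<tau>\<close> may be less than 1, so that gradients need not be locally integrable. Hence
  the estimates are carried by an integrable \<open>F\<close> standing for a
  \<open>\<tau>\<close>-th power, the averages avoid points with large \<open>F\<close>, and the
  remaining term \<open>F^b\<close> is cut off at a level depending on \<open>\<rho>\<close>, which
  uses that the function is bounded. The lower mass bound behind
  \<open>H \<le> A \<rho>^(-n)\<close> is uniform only on bounded sets; so one ball is fixed, and
  balls exhaust the space at the end.\<close>

fun variation :: "(real \<Rightarrow> 'a::metric_space) \<Rightarrow> real list \<Rightarrow> real" where
  "variation \<gamma> [] = 0"
| "variation \<gamma> [a] = 0"
| "variation \<gamma> (a # b # ts) = dist (\<gamma> a) (\<gamma> b) + variation \<gamma> (b # ts)"

lemma variation_nonneg: "0 \<le> variation \<gamma> ts"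
  by (induction \<gamma> ts rule: variation.induct) auto

lemma variation_eq_sum:
  "variation \<gamma> ts = (\<Sum>i<length ts - 1. dist (\<gamma> (ts ! i)) (\<gamma> (ts ! Suc i)))"
proof (induction \<gamma> ts rule: variation.induct)
  case (3 \<gamma> a b ts)
  show ?case
    using 3 by (simp add: sum.lessThan_Suc_shift del: sum.lessThan_Suc)
qed auto

lemma variation_split: "variation \<gamma> (xs @ a # ys) = variation \<gamma> (xs @ [a]) + variation \<gamma> (a # ys)"
proof (induction xs)
  case (Cons x xs)
  then show ?case by (cases xs) auto
qed simp

lemma variation_Cons: "variation \<gamma> ys \<le> variation \<gamma> (a # ys)"
  by (cases ys) auto

lemma variation_insert: "variation \<gamma> (xs @ ys) \<le> variation \<gamma> (xs @ a # ys)"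
proof (induction xs)
  case Nil
  then show ?case by (simp add: variation_Cons)
next
  case (Cons x xs)
  show ?case
  proof (cases xs)
    case Nil
    then show ?thesis
      using dist_triangle[of "\<gamma> x" _ "\<gamma> a"] by (cases ys) (auto simp: algebra_simps)
  next
    case (Cons x' xs')
    then show ?thesis using Cons.IH by auto
  qed
qed

lemma curve_length_variation:
  "curve_length \<gamma> a b = (SUP ts\<in>{ts. sorted ts \<and> set ts \<subseteq> {a..b}}. ennreal (variation \<gamma> ts))"
  by (simp add: curve_length_def variation_eq_sum)

lemma variation_le_curve_length:
  assumes "sorted ts" "set ts \<subseteq> {a..b}"
  shows "ennreal (variation \<gamma> ts) \<le> curve_length \<gamma> a b"
  unfolding curve_length_variation using assms by (auto intro: SUP_upper)

lemma sorted_split_at: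
  fixes p q :: real
  assumes "sorted ts" "set ts \<inter> {p<..<q} = {}" "p \<le> q"
  obtains xs ys where "ts = xs @ ys" "\<forall>x\<in>set xs. x \<le> p" "\<forall>y\<in>set ys. q \<le> y" "sorted xs" "sorted ys"
proof
  show "ts = takeWhile (\<lambda>x. x \<le> p) ts @ dropWhile (\<lambda>x. x \<le> p) ts" by simp
  show "\<forall>x\<in>set (takeWhile (\<lambda>x. x \<le> p) ts). x \<le> p"
    by (meson set_takeWhileD)
  show "sorted (takeWhile (\<lambda>x. x \<le> p) ts)" "sorted (dropWhile (\<lambda>x. x \<le> p) ts)"
    using assms by (auto simp: sorted_takeWhile sorted_dropWhile)
  show "\<forall>y\<in>set (dropWhile (\<lambda>x. x \<le> p) ts). q \<le> y"
  proof
    fix y assume y: "y \<in> set (dropWhile (\<lambda>x. x \<le> p) ts)"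
    have yt: "y \<in> set ts" using y by (meson set_dropWhileD)
    have ne: "dropWhile (\<lambda>x. x \<le> p) ts \<noteq> []" using y by (metis empty_iff list.set(1))
    have "\<not> hd (dropWhile (\<lambda>x. x \<le> p) ts) \<le> p"
      using ne by (metis hd_dropWhile dropWhile_eq_Nil_conv)
    moreover have "hd (dropWhile (\<lambda>x. x \<le> p) ts) \<le> y"
      using sorted_dropWhile[OF assms(1), of "\<lambda>x. x \<le> p"] y
      by (cases "dropWhile (\<lambda>x. x \<le> p) ts") auto
    ultimately have "p < y" by simp
    then show "q \<le> y" using yt assms(2) by force
  qed
qed

text \<open>The list falls into a part up to \<open>p\<close> and a part from \<open>q\<close> on,
  and inserting \<open>p\<close> and \<open>q\<close> between them only increases the variation.
  With \<open>p = q\<close> this yields additivity of length, with \<open>p < q\<close> its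
  continuity.\<close>

lemma variation_le_gap:
  assumes ts: "sorted ts" "set ts \<subseteq> {a..b}" and gap: "set ts \<inter> {p<..<q} = {}"
    and pq: "a \<le> p" "p \<le> q" "q \<le> b"
  shows "ennreal (variation \<gamma> ts)
    \<le> curve_length \<gamma> a p + ennreal (dist (\<gamma> p) (\<gamma> q)) + curve_length \<gamma> q b"
proof -
  obtain xs ys where t: "ts = xs @ ys" and x: "\<forall>x\<in>set xs. x \<le> p" and y: "\<forall>y\<in>set ys. q \<le> y"
    and s: "sorted xs" "sorted ys"
    using sorted_split_at[OF ts(1) gap pq(2)] by metis
  have "variation \<gamma> ts \<le> variation \<gamma> (xs @ q # ys)"
    unfolding t by (rule variation_insert)
  also have "\<dots> \<le> variation \<gamma> (xs @ p # q # ys)"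
    by (rule variation_insert)
  also have "\<dots> = variation \<gamma> (xs @ [p]) + dist (\<gamma> p) (\<gamma> q) + variation \<gamma> (q # ys)"
    by (subst variation_split) simp
  finally have "ennreal (variation \<gamma> ts) \<le> ennreal (variation \<gamma> (xs @ [p]))
      + ennreal (dist (\<gamma> p) (\<gamma> q)) + ennreal (variation \<gamma> (q # ys))"
    by (simp add: variation_nonneg flip: ennreal_plus)
  also have "\<dots> \<le> curve_length \<gamma> a p + ennreal (dist (\<gamma> p) (\<gamma> q)) + curve_length \<gamma> q b"
    using ts(2) x y s pq unfolding t
    by (intro add_mono order_refl variation_le_curve_length) (auto simp: sorted_append)
  finally show ?thesis .
qed

lemma curve_length_add:
  assumes "a \<le> c" "c \<le> b"
  shows "curve_length \<gamma> a b = curve_length \<gamma> a c + curve_length \<gamma> c b"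
proof (rule antisym)
  show "curve_length \<gamma> a b \<le> curve_length \<gamma> a c + curve_length \<gamma> c b"
    unfolding curve_length_variation[of \<gamma> a b]
  proof (rule SUP_least)
    fix ts assume "ts \<in> {ts. sorted ts \<and> set ts \<subseteq> {a..b}}"
    then show "ennreal (variation \<gamma> ts) \<le> curve_length \<gamma> a c + curve_length \<gamma> c b"
      using variation_le_gap[of ts a b c c \<gamma>] assms by auto
  qed
  have "curve_length \<gamma> a c + curve_length \<gamma> c b
    = (SUP xs\<in>{ts. sorted ts \<and> set ts \<subseteq> {a..c}}. ennreal (variation \<gamma> xs) + curve_length \<gamma> c b)"
    unfolding curve_length_variation[of \<gamma> a c]
    by (subst ennreal_SUP_add_left) (auto intro!: exI[of _ "[]"])
  also have "\<dots> \<le> curve_length \<gamma> a b"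
  proof (rule SUP_least)
    fix xs assume "xs \<in> {ts. sorted ts \<and> set ts \<subseteq> {a..c}}"
    then have xs: "sorted xs" "set xs \<subseteq> {a..c}" by auto
    have "ennreal (variation \<gamma> xs) + curve_length \<gamma> c b
      = (SUP ys\<in>{ts. sorted ts \<and> set ts \<subseteq> {c..b}}. ennreal (variation \<gamma> xs) + ennreal (variation \<gamma> ys))"
      unfolding curve_length_variation[of \<gamma> c b]
      by (subst ennreal_SUP_add_right) (auto intro!: exI[of _ "[]"])
    also have "\<dots> \<le> curve_length \<gamma> a b"
    proof (rule SUP_least)
      fix ys assume "ys \<in> {ts. sorted ts \<and> set ts \<subseteq> {c..b}}"
      then have ys: "sorted ys" "set ys \<subseteq> {c..b}" by auto
      have "variation \<gamma> xs + variation \<gamma> ys \<le> variation \<gamma> (xs @ [c]) + variation \<gamma> (c # ys)"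
        using variation_insert[of \<gamma> xs "[]" c] variation_Cons[of \<gamma> ys c] by simp
      also have "\<dots> = variation \<gamma> (xs @ c # ys)" by (simp add: variation_split[symmetric])
      finally have "ennreal (variation \<gamma> xs) + ennreal (variation \<gamma> ys) \<le> ennreal (variation \<gamma> (xs @ c # ys))"
        by (simp add: variation_nonneg flip: ennreal_plus)
      also have "\<dots> \<le> curve_length \<gamma> a b"
        using xs ys assms by (intro variation_le_curve_length) (fastforce simp: sorted_append)+
      finally show "ennreal (variation \<gamma> xs) + ennreal (variation \<gamma> ys) \<le> curve_length \<gamma> a b" .
    qed
    finally show "ennreal (variation \<gamma> xs) + curve_length \<gamma> c b \<le> curve_length \<gamma> a b" .
  qed
  finally show "curve_length \<gamma> a c + curve_length \<gamma> c b \<le> curve_length \<gamma> a b" .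
qed

section \<open>Continuity of arc length and the arc-length parametrization\<close>

lemma dist_le_curve_length: "a \<le> b \<Longrightarrow> ennreal (dist (\<gamma> a) (\<gamma> b)) \<le> curve_length \<gamma> a b"
  using variation_le_curve_length[of "[a, b]" a b \<gamma>] by simp

text \<open>Some finite list \<open>ts\<close> almost attains the total length. On an interval whose
  interior misses \<open>ts\<close> the variation sum sees only the distance of the end points, so
  the length there exceeds this distance by less than \<open>e/3\<close>; continuity of
  \<open>\<gamma>\<close> makes the distance small.\<close>

lemma curve_length_continuous:
  assumes \<gamma>: "path \<gamma>" and fin: "curve_length \<gamma> 0 1 < \<infinity>"
  shows "continuous_on {0..1} (\<lambda>t. enn2real (curve_length \<gamma> 0 t))"
proof -
  have finite: "curve_length \<gamma> p q < \<infinity>" if "0 \<le> p" "p \<le> q" "q \<le> 1" for p q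
  proof -
    have "curve_length \<gamma> 0 1 = curve_length \<gamma> 0 p + (curve_length \<gamma> p q + curve_length \<gamma> q 1)"
      using that curve_length_add[of 0 p 1 \<gamma>] curve_length_add[of p q 1 \<gamma>] by simp
    then show ?thesis using fin by (simp add: ennreal_add_less_top)
  qed
  have add: "enn2real (curve_length \<gamma> p r) = enn2real (curve_length \<gamma> p q) + enn2real (curve_length \<gamma> q r)"
    if "0 \<le> p" "p \<le> q" "q \<le> r" "r \<le> 1" for p q r
    using that curve_length_add[of p q r \<gamma>] finite[of p q] finite[of q r]
    by (simp add: enn2real_plus)
  have cont: "continuous_on {0..1} \<gamma>" using \<gamma> by (simp add: path_def)
  show ?thesis
    unfolding continuous_on_iff
  proof (intro ballI allI impI)
    fix r e :: real assume r: "r \<in> {0..1}" and e: "0 < e"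
    let ?L = "enn2real (curve_length \<gamma> 0 1)"
    have L: "curve_length \<gamma> 0 1 = ennreal ?L" using fin by simp
    obtain ts where ts: "sorted ts" "set ts \<subseteq> {0..1}" "?L - e/3 < variation \<gamma> ts"
    proof (cases "?L - e/3 < 0")
      case True
      then show ?thesis using that[of "[]"] by simp
    next
      case False
      then have "ennreal (?L - e/3) < curve_length \<gamma> 0 1"
        using e by (subst L) (simp add: ennreal_less_iff)
      then obtain ts where "sorted ts" "set ts \<subseteq> {0..1}" "ennreal (?L - e/3) < ennreal (variation \<gamma> ts)"
        unfolding curve_length_variation by (auto simp: less_SUP_iff)
      then show ?thesis using that False by (simp add: ennreal_less_iff)
    qed
    obtain d1 where d1: "0 < d1" "\<And>r'. r' \<in> {0..1} \<Longrightarrow> dist r' r < d1 \<Longrightarrow> dist (\<gamma> r') (\<gamma> r) < e/3"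
      using cont r e unfolding continuous_on_iff by (metis zero_less_divide_iff zero_less_numeral)
    \<comment> \<open>The point \<open>r\<close> may itself belong to \<open>ts\<close>; only the
      open interval between \<open>r\<close> and \<open>r'\<close> has to avoid the list.\<close>
    obtain d2 where d2: "0 < d2" "\<forall>t\<in>set ts. t \<noteq> r \<longrightarrow> d2 \<le> dist r t"
      using finite_set_avoid[of "set ts" r] by auto
    have key: "enn2real (curve_length \<gamma> p q) < e"
      if pq: "0 \<le> p" "p \<le> q" "q \<le> 1" and "dist (\<gamma> p) (\<gamma> q) < e/3" "set ts \<inter> {p<..<q} = {}" for p q
    proof -
      have fin': "curve_length \<gamma> 0 p = ennreal (enn2real (curve_length \<gamma> 0 p))"
          "curve_length \<gamma> q 1 = ennreal (enn2real (curve_length \<gamma> q 1))"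
        using finite pq by (simp_all)
      have "ennreal (variation \<gamma> ts)
        \<le> curve_length \<gamma> 0 p + ennreal (dist (\<gamma> p) (\<gamma> q)) + curve_length \<gamma> q 1"
        using variation_le_gap[OF ts(1,2) that(5)] pq by auto
      then have "ennreal (variation \<gamma> ts)
        \<le> ennreal (enn2real (curve_length \<gamma> 0 p) + dist (\<gamma> p) (\<gamma> q) + enn2real (curve_length \<gamma> q 1))"
        by (subst (asm) fin'(1), subst (asm) fin'(2)) (simp add: ennreal_plus[symmetric] del: ennreal_plus ennreal_enn2real)
      then have "variation \<gamma> ts
        \<le> enn2real (curve_length \<gamma> 0 p) + dist (\<gamma> p) (\<gamma> q) + enn2real (curve_length \<gamma> q 1)"
        by (subst (asm) ennreal_le_iff) auto
      moreover have "?L = enn2real (curve_length \<gamma> 0 p) + enn2real (curve_length \<gamma> p q) + enn2real (curve_length \<gamma> q 1)"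
        using add[of 0 p 1] add[of p q 1] pq by simp
      ultimately show ?thesis using ts(3) that(4) e by linarith
    qed
    show "\<exists>d>0. \<forall>r'\<in>{0..1}. dist r' r < d \<longrightarrow>
      dist (enn2real (curve_length \<gamma> 0 r')) (enn2real (curve_length \<gamma> 0 r)) < e"
    proof (intro exI[of _ "min d1 d2"] conjI ballI impI)
      show "0 < min d1 d2" using d1 d2 by simp
      fix r' :: real assume r': "r' \<in> {0..1}" "dist r' r < min d1 d2"
      have dd: "dist (\<gamma> r') (\<gamma> r) < e/3" using d1 r' by auto
      have avoid: "set ts \<inter> {min r r'<..<max r r'} = {}"
      proof (rule equals0I)
        fix t assume t: "t \<in> set ts \<inter> {min r r'<..<max r r'}"
        then have "t \<noteq> r" "dist r t < dist r' r" by (auto simp: dist_real_def)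
        then show False using d2 t r' by auto
      qed
      show "dist (enn2real (curve_length \<gamma> 0 r')) (enn2real (curve_length \<gamma> 0 r)) < e"
      proof (cases "r \<le> r'")
        case True
        then show ?thesis
          using key[of r r'] add[of 0 r r'] r r' dd avoid
          by (simp add: dist_real_def dist_commute min_def max_def)
      next
        case False
        then show ?thesis
          using key[of r' r] add[of 0 r' r] r r' dd avoid
          by (simp add: dist_real_def dist_commute min_def max_def)
      qed
    qed
  qed
qed

lemma curve_length_mono: "0 \<le> a \<Longrightarrow> a \<le> b \<Longrightarrow> curve_length \<gamma> 0 a \<le> curve_length \<gamma> 0 b"
  using curve_length_add[of 0 a b \<gamma>] by simp

text \<open>The intermediate value theorem for arc length provides a parameter, so the choice in
  \<open>arclength_param\<close> has the property it asks for. Which parameter is chosen remains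
  open.\<close>

lemma arclength_param_eq:
  assumes \<gamma>: "path \<gamma>" and fin: "curve_length \<gamma> 0 1 < \<infinity>"
    and t: "0 \<le> t" "t \<le> enn2real (curve_length \<gamma> 0 1)"
  obtains r where "r \<in> {0..1}" "curve_length \<gamma> 0 r = ennreal t" "arclength_param \<gamma> t = \<gamma> r"
proof -
  have z: "curve_length \<gamma> 0 0 = 0"
  proof -
    have "curve_length \<gamma> 0 0 \<le> curve_length \<gamma> 0 1" by (rule curve_length_mono) auto
    then have "curve_length \<gamma> 0 0 < \<infinity>" using fin by simp
    then show ?thesis using curve_length_add[of 0 0 0 \<gamma>]
      by (metis add.right_neutral ennreal_add_left_cancel infinity_ennreal_def less_irrefl order_refl)
  qed
  have "\<exists>r\<ge>0. r \<le> 1 \<and> enn2real (curve_length \<gamma> 0 r) = t"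
    using t z by (intro IVT' curve_length_continuous[OF \<gamma> fin]) auto
  then obtain r where r: "0 \<le> r" "r \<le> 1" "enn2real (curve_length \<gamma> 0 r) = t" by auto
  have "curve_length \<gamma> 0 r < \<infinity>" using curve_length_mono[of r 1 \<gamma>] r fin by (simp add: order_le_less_trans)
  then have "\<exists>r. r \<in> {0..1} \<and> curve_length \<gamma> 0 r = ennreal t"
    using r by (intro exI[of _ r]) auto
  then show ?thesis
    using that someI_ex[of "\<lambda>r. r \<in> {0..1} \<and> curve_length \<gamma> 0 r = ennreal t"]
    unfolding arclength_param_def by blast
qed

lemma dist_le_curve_length_diff:
  assumes "0 \<le> a" "a \<le> b" "curve_length \<gamma> 0 a = ennreal s" "curve_length \<gamma> 0 b = ennreal t" "0 \<le> s" "0 \<le> t"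
  shows "dist (\<gamma> a) (\<gamma> b) \<le> t - s"
proof -
  have "ennreal s + ennreal (dist (\<gamma> a) (\<gamma> b)) \<le> ennreal t"
    using curve_length_add[of 0 a b \<gamma>] dist_le_curve_length[of a b \<gamma>] assms
    by (metis add_left_mono)
  then show ?thesis using assms by (simp flip: ennreal_plus)
qed

lemma arclength_param_lipschitz:
  assumes \<gamma>: "path \<gamma>" and fin: "curve_length \<gamma> 0 1 < \<infinity>"
    and t: "0 \<le> s" "s \<le> t" "t \<le> enn2real (curve_length \<gamma> 0 1)"
  shows "dist (arclength_param \<gamma> s) (arclength_param \<gamma> t) \<le> t - s"
proof -
  obtain a where a: "a \<in> {0..1}" "curve_length \<gamma> 0 a = ennreal s" "arclength_param \<gamma> s = \<gamma> a"
    using arclength_param_eq[OF \<gamma> fin, of s] t by auto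
  obtain b where b: "b \<in> {0..1}" "curve_length \<gamma> 0 b = ennreal t" "arclength_param \<gamma> t = \<gamma> b"
    using arclength_param_eq[OF \<gamma> fin, of t] t by auto
  show ?thesis
  proof (cases "a \<le> b")
    case True
    then show ?thesis using dist_le_curve_length_diff[of a b \<gamma> s t] a b t by simp
  next
    case False
    \<comment> \<open>Length is monotone in the parameter, so the chosen parameters can be in
      reverse order only if \<open>s = t\<close>.\<close>
    then have "t \<le> s" using curve_length_mono[of b a \<gamma>] a b t by simp
    then show ?thesis using dist_le_curve_length_diff[of b a \<gamma> t s] False a b t by (simp add: dist_commute)
  qed
qed

lemma arclength_param_ends:
  assumes \<gamma>: "path \<gamma>" and fin: "curve_length \<gamma> 0 1 < \<infinity>"
  shows "arclength_param \<gamma> 0 = pathstart \<gamma>"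
    and "arclength_param \<gamma> (enn2real (curve_length \<gamma> 0 1)) = pathfinish \<gamma>"
proof -
  let ?L = "enn2real (curve_length \<gamma> 0 1)"
  obtain a where a: "a \<in> {0..1}" "curve_length \<gamma> 0 a = ennreal 0" "arclength_param \<gamma> 0 = \<gamma> a"
    using arclength_param_eq[OF \<gamma> fin, of 0] by auto
  have "curve_length \<gamma> 0 0 = 0"
    using curve_length_mono[of 0 a \<gamma>] a by simp
  then show "arclength_param \<gamma> 0 = pathstart \<gamma>"
    using dist_le_curve_length_diff[of 0 a \<gamma> 0 0] a by (simp add: pathstart_def)
  obtain b where b: "b \<in> {0..1}" "curve_length \<gamma> 0 b = ennreal ?L" "arclength_param \<gamma> ?L = \<gamma> b"
    using arclength_param_eq[OF \<gamma> fin, of ?L] by auto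
  show "arclength_param \<gamma> ?L = pathfinish \<gamma>"
    using dist_le_curve_length_diff[of b 1 \<gamma> ?L ?L] b fin by (simp add: pathfinish_def)
qed

text \<open>On a parameter interval of length less than \<open>\<delta>\<close> the increment of \<open>v\<close> is at most the length
  times the value of \<open>h\<close> at any point of the interval, hence at most the integral of \<open>h\<close>.\<close>

lemma upper_gradient_curve:
  fixes v h :: "'a::metric_space \<Rightarrow> real"
  assumes \<gamma>: "path \<gamma>" and fin: "curve_length \<gamma> 0 1 < \<infinity>"
    and h: "continuous_on UNIV h" "\<And>x. 0 \<le> h x"
    and \<delta>: "0 < \<delta>" "\<And>x y. dist x y < \<delta> \<Longrightarrow> \<bar>v x - v y\<bar> \<le> dist x y * h x"
  shows "ennreal \<bar>v (pathstart \<gamma>) - v (pathfinish \<gamma>)\<bar> \<le> curve_integral \<gamma> (\<lambda>x. ennreal (h x))"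
proof -
  define L where "L = enn2real (curve_length \<gamma> 0 1)"
  define c where "c = arclength_param \<gamma>"
  have lip: "dist (c s) (c t) \<le> \<bar>t - s\<bar>" if "s \<in> {0..L}" "t \<in> {0..L}" for s t
    using arclength_param_lipschitz[OF \<gamma> fin, of s t] arclength_param_lipschitz[OF \<gamma> fin, of t s] that
    unfolding c_def L_def by (cases "s \<le> t") (auto simp: dist_commute)
  have contc: "continuous_on {0..L} c"
    unfolding continuous_on_iff
  proof (intro ballI allI impI)
    fix t e :: real assume "t \<in> {0..L}" "0 < e"
    then show "\<exists>d>0. \<forall>s\<in>{0..L}. dist s t < d \<longrightarrow> dist (c s) (c t) < e"
      by (intro exI[of _ e]) (auto simp: dist_real_def intro!: order_le_less_trans[OF lip])
  qed
  have conth: "continuous_on {0..L} (\<lambda>t. h (c t))"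
    by (rule continuous_on_compose2[OF h(1) contc]) auto
  have meas: "(\<lambda>t. ennreal (h (c t)) * indicator {a..b} t) \<in> borel_measurable lborel" if "{a..b} \<subseteq> {0..L}" for a b
  proof -
    have "(\<lambda>t. indicator {a..b} t *\<^sub>R h (c t)) \<in> borel_measurable borel"
      by (rule borel_measurable_continuous_on_indicator) (auto intro: continuous_on_subset[OF conth that])
    then have "(\<lambda>t. ennreal (indicator {a..b} t *\<^sub>R h (c t))) \<in> borel_measurable lborel" by simp
    also have "(\<lambda>t. ennreal (indicator {a..b} t *\<^sub>R h (c t))) = (\<lambda>t. ennreal (h (c t)) * indicator {a..b} t)"
      by (auto simp: indicator_def)
    finally show ?thesis .
  qed
  have small: "ennreal \<bar>v (c a) - v (c b)\<bar> \<le> (\<integral>\<^sup>+t\<in>{a..b}. ennreal (h (c t)) \<partial>lborel)"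
    if ab: "0 \<le> a" "a \<le> b" "b \<le> L" "b - a < \<delta>" for a b
  proof (cases "a = b")
    case False
    have "\<bar>v (c a) - v (c b)\<bar> \<le> (b - a) * h (c t)" if t: "t \<in> {a..b}" for t
    proof -
      have la: "dist (c t) (c a) \<le> t - a" and lb: "dist (c t) (c b) \<le> b - t"
        using lip[of t a] lip[of t b] t ab by auto
      have "\<bar>v (c t) - v (c a)\<bar> \<le> dist (c t) (c a) * h (c t)"
        using \<delta>(2)[of "c t" "c a"] la t ab by simp
      also have "\<dots> \<le> (t - a) * h (c t)" using la h by (intro mult_right_mono) auto
      finally have 1: "\<bar>v (c t) - v (c a)\<bar> \<le> (t - a) * h (c t)" .
      have "\<bar>v (c t) - v (c b)\<bar> \<le> dist (c t) (c b) * h (c t)"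
        using \<delta>(2)[of "c t" "c b"] lb t ab by simp
      also have "\<dots> \<le> (b - t) * h (c t)" using lb h by (intro mult_right_mono) auto
      finally have "\<bar>v (c t) - v (c b)\<bar> \<le> (b - t) * h (c t)" .
      with 1 show ?thesis by (simp add: algebra_simps abs_if split: if_splits)
    qed
    then have *: "\<bar>v (c a) - v (c b)\<bar> / (b - a) \<le> h (c t)" if "t \<in> {a..b}" for t
      using that ab False by (simp add: field_simps)
    have "ennreal \<bar>v (c a) - v (c b)\<bar> = ennreal (\<bar>v (c a) - v (c b)\<bar> / (b - a)) * ennreal (b - a)"
      using ab False by (simp flip: ennreal_mult)
    also have "\<dots> = (\<integral>\<^sup>+t\<in>{a..b}. ennreal (\<bar>v (c a) - v (c b)\<bar> / (b - a)) \<partial>lborel)"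
      using ab by (simp add: nn_integral_cmult_indicator)
    also have "\<dots> \<le> (\<integral>\<^sup>+t\<in>{a..b}. ennreal (h (c t)) \<partial>lborel)"
      by (intro nn_integral_mono) (auto simp: indicator_def intro!: ennreal_leI *)
    finally show ?thesis .
  qed simp
  have L0: "0 \<le> L" by (simp add: L_def)
  obtain N :: nat where N: "0 < N" "L / N < \<delta>"
  proof -
    obtain N :: nat where "L / \<delta> < N" using reals_Archimedean2 by blast
    then have "L / \<delta> < Suc N" by simp
    then show ?thesis using that[of "Suc N"] \<delta> by (simp add: field_simps)
  qed
  have "ennreal \<bar>v (c 0) - v (c (i * L / N))\<bar> \<le> (\<integral>\<^sup>+t\<in>{0..i * L / N}. ennreal (h (c t)) \<partial>lborel)"
    if "i \<le> N" for i :: nat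
    using that
  proof (induction i)
    case (Suc i)
    let ?a = "i * L / N" and ?b = "Suc i * L / N"
    have a: "0 \<le> ?a" "?a \<le> ?b" using L0 N by (auto simp: divide_simps mult_right_mono)
    have b: "?b \<le> L"
      using Suc.prems L0 N mult_right_mono[of "Suc i" N L] by (simp add: divide_simps mult.commute)
    have ba: "?b - ?a < \<delta>" using N by (simp add: divide_simps algebra_simps)
    have "ennreal \<bar>v (c 0) - v (c ?b)\<bar> \<le> ennreal (\<bar>v (c 0) - v (c ?a)\<bar> + \<bar>v (c ?a) - v (c ?b)\<bar>)"
      by (intro ennreal_leI) auto
    also have "\<dots> \<le> (\<integral>\<^sup>+t\<in>{0..?a}. ennreal (h (c t)) \<partial>lborel) + (\<integral>\<^sup>+t\<in>{?a..?b}. ennreal (h (c t)) \<partial>lborel)"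
      using Suc small[OF a b ba] by (simp add: add_mono)
    also have "\<dots> = (\<integral>\<^sup>+t. ennreal (h (c t)) * indicator {0..?a} t + ennreal (h (c t)) * indicator {?a..?b} t \<partial>lborel)"
      using a b by (intro nn_integral_add[symmetric] meas) auto
    \<comment> \<open>The two closed intervals share only the point \<open>?a\<close>, a Lebesgue
      null set.\<close>
    also have "\<dots> \<le> (\<integral>\<^sup>+t\<in>{0..?b}. ennreal (h (c t)) \<partial>lborel)"
    proof (rule nn_integral_mono_AE)
      show "AE t in lborel. ennreal (h (c t)) * indicator {0..?a} t + ennreal (h (c t)) * indicator {?a..?b} t
        \<le> ennreal (h (c t)) * indicator {0..?b} t"
        using AE_lborel_singleton[of ?a] by eventually_elim (use a in \<open>auto simp: indicator_def\<close>)
    qed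
    finally show ?case .
  qed simp
  from this[of N] N have "ennreal \<bar>v (c 0) - v (c L)\<bar> \<le> (\<integral>\<^sup>+t\<in>{0..L}. ennreal (h (c t)) \<partial>lborel)"
    by simp
  then show ?thesis
    using arclength_param_ends[OF \<gamma> fin] by (simp add: c_def L_def curve_integral_def)
qed

text \<open>The bound involves \<open>h\<close> at one of the two points only, and
  \<open>\<delta>\<close> is uniform in both. This suffices to integrate along every rectifiable
  curve, so the exceptional family in \<open>weak_upper_gradient\<close> can be empty. The property
  is stable under sums and nonnegative multiples, as the arithmetic means require.\<close>

definition local_slope_bound :: "('a::metric_space \<Rightarrow> real) \<Rightarrow> ('a \<Rightarrow> real) \<Rightarrow> bool" where
  "local_slope_bound v h \<longleftrightarrow> continuous_on UNIV h \<and> (\<forall>x. 0 \<le> h x) \<and>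
     (\<exists>\<delta>>0. \<forall>x y. dist x y < \<delta> \<longrightarrow> \<bar>v x - v y\<bar> \<le> dist x y * h x)"

lemma modulus_empty: "modulus M p {} = 0"
proof -
  have "modulus M p {} \<le> (\<integral>\<^sup>+x. epowr ((\<lambda>_. 0) x) p \<partial>M)"
    unfolding modulus_def by (rule INF_lower) simp
  also have "\<dots> = 0" by (simp add: epowr_def)
  finally show ?thesis by simp
qed

lemma local_slope_bound_weak_upper_gradient:
  assumes "local_slope_bound v h"
  shows "weak_upper_gradient M p v h"
proof -
  from assms obtain \<delta> where h: "continuous_on UNIV h" "\<And>x. 0 \<le> h x" and \<delta>: "\<delta> > 0"
    "\<And>x y. dist x y < \<delta> \<Longrightarrow> \<bar>v x - v y\<bar> \<le> dist x y * h x"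
    by (auto simp: local_slope_bound_def)
  show ?thesis
    unfolding weak_upper_gradient_def
    using h upper_gradient_curve[OF _ _ h \<delta>]
    by (auto intro!: exI[of _ "{}"] borel_measurable_continuous_onI simp: modulus_empty rect_curves_def)
qed

lemma local_slope_bound_continuous:
  assumes "local_slope_bound v h"
  shows "continuous_on UNIV v"
proof -
  from assms obtain \<delta> where h: "\<And>x. 0 \<le> h x" and \<delta>: "\<delta> > 0"
    "\<And>x y. dist x y < \<delta> \<Longrightarrow> \<bar>v x - v y\<bar> \<le> dist x y * h x"
    by (auto simp: local_slope_bound_def)
  show ?thesis
    unfolding continuous_on_iff
  proof (intro ballI allI impI)
    fix x and e :: real assume e: "0 < e"
    show "\<exists>d>0. \<forall>x'\<in>UNIV. dist x' x < d \<longrightarrow> dist (v x') (v x) < e"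
    proof (intro exI[of _ "min \<delta> (e / (h x + 1))"] conjI ballI impI)
      show "0 < min \<delta> (e / (h x + 1))" using \<delta> e h[of x] by (simp add: add_nonneg_pos)
      fix x' assume d: "dist x' x < min \<delta> (e / (h x + 1))"
      have hx: "0 < h x + 1" using h[of x] by simp
      have "\<bar>v x - v x'\<bar> \<le> dist x x' * h x" using \<delta>(2)[of x x'] d by (simp add: dist_commute)
      also have "\<dots> \<le> dist x x' * (h x + 1)" by (intro mult_left_mono) auto
      also have "\<dots> < e" using d hx by (simp add: dist_commute pos_less_divide_eq)
      finally show "dist (v x') (v x) < e" by (simp add: dist_real_def abs_minus_commute)
    qed
  qed
qed

lemma local_slope_bound_add:
  assumes "local_slope_bound v h" "local_slope_bound v' h'"
  shows "local_slope_bound (\<lambda>x. v x + v' x) (\<lambda>x. h x + h' x)"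
proof -
  from assms obtain \<delta> \<delta>' where \<delta>: "\<delta> > 0" "\<And>x y. dist x y < \<delta> \<Longrightarrow> \<bar>v x - v y\<bar> \<le> dist x y * h x"
    and \<delta>': "\<delta>' > 0" "\<And>x y. dist x y < \<delta>' \<Longrightarrow> \<bar>v' x - v' y\<bar> \<le> dist x y * h' x"
    by (auto simp: local_slope_bound_def)
  have "\<bar>v x + v' x - (v y + v' y)\<bar> \<le> dist x y * (h x + h' x)" if "dist x y < min \<delta> \<delta>'" for x y
    using \<delta>(2)[of x y] \<delta>'(2)[of x y] that by (simp add: algebra_simps abs_if split: if_splits)
  then show ?thesis
    using assms \<delta>(1) \<delta>'(1) unfolding local_slope_bound_def
    by (intro conjI exI[of _ "min \<delta> \<delta>'"]) (auto intro: continuous_intros)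
qed

lemma local_slope_bound_scale:
  assumes "local_slope_bound v h" "0 \<le> c"
  shows "local_slope_bound (\<lambda>x. c * v x) (\<lambda>x. c * h x)"
proof -
  from assms obtain \<delta> where \<delta>: "\<delta> > 0" "\<And>x y. dist x y < \<delta> \<Longrightarrow> \<bar>v x - v y\<bar> \<le> dist x y * h x"
    by (auto simp: local_slope_bound_def)
  have "\<bar>c * v x - c * v y\<bar> \<le> dist x y * (c * h x)" if "dist x y < \<delta>" for x y
  proof -
    have "\<bar>c * v x - c * v y\<bar> = c * \<bar>v x - v y\<bar>" using assms(2) by (simp add: abs_mult flip: right_diff_distrib)
    also have "\<dots> \<le> c * (dist x y * h x)" using \<delta>(2)[OF that] assms(2) by (rule mult_left_mono)
    finally show ?thesis by (simp add: algebra_simps)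
  qed
  then show ?thesis
    using assms \<delta>(1) unfolding local_slope_bound_def by (auto intro!: continuous_intros)
qed

section \<open>Mollification in doubling spaces\<close>

locale doubling_space =
  fixes M :: "'a::metric_space measure" and C\<^sub>1 n :: real
  assumes doubling: "doubling_metric_measure_space M C\<^sub>1 n"
begin

lemma space_M [simp]: "space M = UNIV"
  and borel_subset: "sets borel \<subseteq> sets M"
  and C1: "1 < C\<^sub>1" and n: "0 < n"
  using doubling by (auto simp: doubling_metric_measure_space_def borel_regular_def)

lemma ball_sets [measurable, simp]: "ball x r \<in> sets M"
  using borel_subset by auto

lemma borel_measurable_from_borel: "f \<in> borel_measurable borel \<Longrightarrow> f \<in> borel_measurable M"
  using borel_subset by (auto simp: measurable_def)

lemma continuous_measurable:
  fixes f :: "'a \<Rightarrow> 'b::topological_space"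
  assumes "continuous_on UNIV f" shows "f \<in> borel_measurable M"
  using assms by (intro borel_measurable_from_borel borel_measurable_continuous_onI)

lemma dist_measurable [measurable]: "(\<lambda>y. dist x y) \<in> borel_measurable M"
  by (intro continuous_measurable continuous_intros)

lemma ball_finite [simp]: "emeasure M (ball x r) < top" "emeasure M (ball x r) \<noteq> top"
proof -
  show "emeasure M (ball x r) < top"
    using doubling by (cases "0 < r") (auto simp: doubling_metric_measure_space_def ball_empty not_less)
  then show "emeasure M (ball x r) \<noteq> top" by simp
qed

lemma ball_emeasure: "emeasure M (ball x r) = ennreal (measure M (ball x r))"
  by (intro emeasure_eq_ennreal_measure) (use ball_finite in simp)

lemma ball_pos: "0 < r \<Longrightarrow> 0 < measure M (ball x r)"
  using doubling ball_finite[of x r]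
  by (auto simp: doubling_metric_measure_space_def measure_def enn2real_positive_iff)

lemma measure_ball_mono: "A \<in> sets M \<Longrightarrow> A \<subseteq> ball x r \<Longrightarrow> measure M A \<le> measure M (ball x r)"
  by (intro measure_mono_fmeasurable fmeasurableI) (auto simp: ball_finite)

lemma measure_ball_le:
  assumes "0 < r" "1 < l" "dist x y + t \<le> l * r"
  shows "measure M (ball y t) \<le> C\<^sub>1 * l powr n * measure M (ball x r)"
proof -
  have "ball y t \<subseteq> ball x (l * r)"
  proof
    fix z assume "z \<in> ball y t"
    then show "z \<in> ball x (l * r)" using dist_triangle[of x z y] assms by auto
  qed
  then have "measure M (ball y t) \<le> measure M (ball x (l * r))"
    by (intro measure_ball_mono) auto
  also have "emeasure M (ball x (l * r)) \<le> ennreal (C\<^sub>1 * l powr n) * emeasure M (ball x r)"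
    using doubling assms by (auto simp: doubling_metric_measure_space_def)
  then have "measure M (ball x (l * r)) \<le> C\<^sub>1 * l powr n * measure M (ball x r)"
    using C1 by (simp add: ball_emeasure flip: ennreal_mult)
  finally show ?thesis .
qed

text \<open>A single constant for all later comparisons of balls. The largest dilation occurs in
  \<open>maxfun_integral\<close>: a ball of radius \<open>14 * R\<close> lies in one of radius
  \<open>28 * R\<close> about another centre.\<close>

definition D :: real where "D = C\<^sub>1 * 30 powr n"

lemma D_ge_1: "1 \<le> D"
proof -
  have "1 * 1 \<le> C\<^sub>1 * 30 powr n" using C1 n by (intro mult_mono ge_one_powr_ge_zero) auto
  then show ?thesis by (simp add: D_def)
qed

lemma measure_ball_le_D:
  assumes "0 < r" "dist x y + t \<le> 30 * r"
  shows "measure M (ball y t) \<le> D * measure M (ball x r)"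
  using measure_ball_le[OF assms(1), of 30 x y t] assms by (simp add: D_def)

section \<open>Separability and measurability of the distance on the product\<close>

lemma finite_separated:
  fixes x0 :: 'a
  assumes e: "0 < e" and N: "0 < N" and S: "S \<subseteq> ball x0 N" and sep: "\<And>x y. x \<in> S \<Longrightarrow> y \<in> S \<Longrightarrow> x \<noteq> y \<Longrightarrow> e \<le> dist x y"
  shows "finite S"
proof -
  \<comment> \<open>The balls of radius \<open>e/2\<close> about points of \<open>T\<close> are
    disjoint and lie in \<open>ball x0 (N + e)\<close>, which in turn lies in
    \<open>ball x (l * (e/2))\<close>. Hence each of them has at least \<open>1/K\<close> times the
    measure \<open>m\<close>, and there are at most \<open>K\<close>.\<close>
  define l where "l = 2 * (2 * N + e) / e"
  define m where "m = measure M (ball x0 (N + e))"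
  define K where "K = C\<^sub>1 * l powr n"
  have l: "1 < l" using e N by (simp add: l_def field_simps)
  have K: "0 < K" using C1 l by (simp add: K_def)
  have m: "0 < m" using ball_pos e N by (simp add: m_def)
  have "card T \<le> nat \<lfloor>K\<rfloor>" if T: "T \<subseteq> S" "finite T" for T
  proof -
    have "disjoint_family_on (\<lambda>x. ball x (e/2)) T"
      unfolding disjoint_family_on_def
    proof (intro ballI impI equals0I)
      fix x y z assume "x \<in> T" "y \<in> T" "x \<noteq> y" "z \<in> ball x (e/2) \<inter> ball y (e/2)"
      then show False using sep[of x y] T dist_triangle_half_l[of x z e y] by (auto simp: dist_commute)
    qed
    then have "measure M (\<Union>x\<in>T. ball x (e/2)) = (\<Sum>x\<in>T. measure M (ball x (e/2)))"
      using T by (intro measure_finite_Union) auto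
    moreover have "measure M (\<Union>x\<in>T. ball x (e/2)) \<le> m"
      unfolding m_def
    proof (intro measure_ball_mono subsetI)
      fix z assume "z \<in> (\<Union>x\<in>T. ball x (e/2))"
      then obtain x where "x \<in> T" "dist x z < e/2" by auto
      then show "z \<in> ball x0 (N + e)" using dist_triangle[of x0 z x] T S e by force
    qed (use T in auto)
    moreover have "m \<le> K * measure M (ball x (e/2))" if "x \<in> T" for x
      unfolding m_def K_def using e N l T S that
      by (intro measure_ball_le) (auto simp: l_def dist_commute field_simps subset_iff)
    then have "(\<Sum>x\<in>T. m / K) \<le> (\<Sum>x\<in>T. measure M (ball x (e/2)))"
      using K by (intro sum_mono) (auto simp: divide_simps mult.commute)
    ultimately have "card T * (m / K) \<le> m" by simp
    then have "card T \<le> K" using m K by (simp add: field_simps)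
    then show ?thesis by linarith
  qed
  then show ?thesis by (metis finite_if_finite_subsets_card_bdd)
qed

text \<open>A maximal \<open>e\<close>-separated set, obtained from Zorn's lemma, is an
  \<open>e\<close>-net, and by \<open>finite_separated\<close> it meets every ball in a finite set.
  The union of such nets for \<open>e = 1 / (j + 1)\<close> is dense.\<close>

lemma countable_dense:
  obtains Q :: "'a set" where "countable Q" "Q \<noteq> {}" "\<And>x e. 0 < e \<Longrightarrow> \<exists>q\<in>Q. dist x q < e"
proof -
  define P where "P e = {S :: 'a set. \<forall>x\<in>S. \<forall>y\<in>S. x \<noteq> y \<longrightarrow> e \<le> dist x y}" for e :: real
  have "\<exists>S\<in>P e. \<forall>X\<in>P e. S \<subseteq> X \<longrightarrow> X = S" for e
  proof (rule subset_Zorn')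
    fix \<C> assume C: "subset.chain (P e) \<C>"
    show "\<Union>\<C> \<in> P e"
      unfolding P_def
    proof (intro CollectI ballI impI)
      fix x y assume "x \<in> \<Union>\<C>" "y \<in> \<Union>\<C>" "x \<noteq> y"
      then obtain X Y where XY: "X \<in> \<C>" "Y \<in> \<C>" "x \<in> X" "y \<in> Y" by auto
      then have "X \<subseteq> Y \<or> Y \<subseteq> X" "X \<in> P e" "Y \<in> P e"
        using C by (auto simp: subset_chain_def)
      then show "e \<le> dist x y" using XY \<open>x \<noteq> y\<close> by (auto simp: P_def)
    qed
  qed
  then obtain S where S: "\<And>e. S e \<in> P e" and max: "\<And>e X. X \<in> P e \<Longrightarrow> S e \<subseteq> X \<Longrightarrow> X = S e" by metis
  have cover: "\<exists>q\<in>S e. dist x q < e" if e: "0 < e" for x e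
  proof (rule ccontr)
    assume *: "\<not> (\<exists>q\<in>S e. dist x q < e)"
    then have "insert x (S e) \<in> P e"
      using S[of e] by (auto simp: P_def not_less dist_commute)
    then have "x \<in> S e" using max[of "insert x (S e)" e] by auto
    then show False using * e by auto
  qed
  have countable: "countable (S e)" if e: "0 < e" for e
  proof -
    obtain x0 :: 'a where True by simp
    have eq: "S e = (\<Union>N::nat. S e \<inter> ball x0 (Suc N))"
    proof -
      have "\<exists>N::nat. dist x0 x < real (Suc N)" for x
      proof -
        obtain N :: nat where "dist x0 x < real N" using reals_Archimedean2 by blast
        then show ?thesis by (intro exI[of _ N]) simp
      qed
      then show ?thesis by auto
    qed
    have "finite (S e \<inter> ball x0 (Suc N))" for N :: nat
      using S[of e] e by (intro finite_separated[of e "Suc N" _ x0]) (auto simp: P_def)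
    then show ?thesis
      by (subst eq) (intro countable_UN, auto intro: countable_finite)
  qed
  show ?thesis
  proof
    show "countable (\<Union>j::nat. S (inverse (Suc j)))"
      by (intro countable_UN countable) auto
    show dense: "\<exists>q\<in>(\<Union>j::nat. S (inverse (Suc j))). dist x q < e" if e: "0 < e" for x e
    proof -
      obtain j :: nat where "inverse (Suc j) < e" using reals_Archimedean[OF e] by auto
      then show ?thesis using cover[of "inverse (Suc j)" x] by force
    qed
    show "(\<Union>j::nat. S (inverse (Suc j))) \<noteq> {}" using dense[of 1 undefined] by auto
  qed
qed

text \<open>An open subset of the product need not lie in the product \<open>\<sigma>\<close>-algebra in general; here
  separability reduces the distance to countably many sums \<open>dist q x + dist q y\<close>.\<close>

lemma dist_measurable_pair [measurable]: "(\<lambda>z. dist (fst z) (snd z)) \<in> borel_measurable (M \<Otimes>\<^sub>M M)"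
proof -
  obtain Q :: "'a set" where Q: "countable Q" "Q \<noteq> {}" "\<And>x e. 0 < e \<Longrightarrow> \<exists>q\<in>Q. dist x q < e"
    using countable_dense by metis
  have "{z \<in> space (M \<Otimes>\<^sub>M M). dist (fst z) (snd z) < t} \<in> sets (M \<Otimes>\<^sub>M M)" for t
  proof -
    have "{z \<in> space (M \<Otimes>\<^sub>M M). dist (fst z) (snd z) < t}
      = (\<Union>q\<in>Q. {z \<in> space (M \<Otimes>\<^sub>M M). dist q (fst z) + dist q (snd z) < t})" (is "?A = ?B")
    proof
      show "?B \<subseteq> ?A" by (auto intro: order_le_less_trans[OF dist_triangle3])
      show "?A \<subseteq> ?B"
      proof
        fix z assume z: "z \<in> ?A"
        then obtain q where q: "q \<in> Q" "dist (fst z) q < (t - dist (fst z) (snd z)) / 2"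
          using Q(3)[of "(t - dist (fst z) (snd z)) / 2" "fst z"] by auto
        have "dist q (snd z) \<le> dist (fst z) q + dist (fst z) (snd z)"
          using dist_triangle[of q "snd z" "fst z"] by (simp add: dist_commute)
        then have "dist q (fst z) + dist q (snd z) < t" using q by (simp add: dist_commute field_simps)
        then show "z \<in> ?B" using z q by auto
      qed
    qed
    also have "\<dots> \<in> sets (M \<Otimes>\<^sub>M M)"
      using Q(1) by (intro sets.countable_UN'') (auto intro: Q(1))
    finally show ?thesis .
  qed
  then show ?thesis by (simp add: borel_measurable_iff_less)
qed

section \<open>Sigma-finiteness, cutoffs and mollified integrals\<close>

sublocale sigma_finite_measure M
proof
  obtain x0 :: 'a where True by simp
  show "\<exists>A. countable A \<and> A \<subseteq> sets M \<and> \<Union>A = space M \<and> (\<forall>a\<in>A. emeasure M a \<noteq> \<infinity>)"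
  proof (intro exI[of _ "range (\<lambda>N::nat. ball x0 N)"] conjI)
    show "\<Union>(range (\<lambda>N::nat. ball x0 N)) = space M"
      by (auto simp: reals_Archimedean2)
  qed auto
qed

text \<open>A cutoff around \<open>x\<close>: for \<open>R > 0\<close> it is 1 up to distance
  \<open>R\<close> and 0 from distance \<open>2 * R\<close> on. It replaces the indicator of a ball
  because integrals against it depend continuously on the centre; its Lipschitz constant
  \<open>1/R\<close> is the source of the slope estimates.\<close>

definition bump :: "real \<Rightarrow> 'a \<Rightarrow> 'a \<Rightarrow> real" where
  "bump R x y = max 0 (min 1 (2 - dist x y / R))"

lemma bump_nonneg [simp]: "0 \<le> bump R x y" and bump_le_1: "bump R x y \<le> 1"
  by (auto simp: bump_def)

lemma bump_eq_1: "0 < R \<Longrightarrow> dist x y \<le> R \<Longrightarrow> bump R x y = 1"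
  by (auto simp: bump_def divide_simps)

lemma bump_eq_0: "0 < R \<Longrightarrow> 2 * R \<le> dist x y \<Longrightarrow> bump R x y = 0"
  by (auto simp: bump_def field_simps max_def min_def)

lemma bump_measurable [measurable]: "bump R x \<in> borel_measurable M"
  unfolding bump_def[abs_def] by measurable

lemma bump_measurable_pair [measurable]: "(\<lambda>z. bump R (fst z) (snd z)) \<in> borel_measurable (M \<Otimes>\<^sub>M M)"
  unfolding bump_def[abs_def] by measurable

lemma bump_lipschitz:
  assumes "0 < R"
  shows "\<bar>bump R x y - bump R x' y\<bar> \<le> dist x x' / R"
proof -
  have "\<bar>dist x y - dist x' y\<bar> \<le> dist x x'"
    by (metis abs_dist_diff_le dist_commute)
  then have "\<bar>dist x y / R - dist x' y / R\<bar> \<le> dist x x' / R"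
    using assms by (simp add: divide_right_mono flip: diff_divide_distrib)
  moreover have "\<bar>max 0 (min 1 (2 - a)) - max 0 (min 1 (2 - b))\<bar> \<le> \<bar>a - b\<bar>" for a b :: real
    by linarith
  ultimately show ?thesis unfolding bump_def by (meson order_trans)
qed

text \<open>Left unnormalized, because \<open>maxfun\<close> divides by the mollification of 1 at a
  different radius.\<close>

definition mollify :: "real \<Rightarrow> ('a \<Rightarrow> real) \<Rightarrow> 'a \<Rightarrow> real" where
  "mollify R f x = (LINT y|M. bump R x y * f y)"

definition locally_integrable :: "('a \<Rightarrow> real) \<Rightarrow> bool" where
  "locally_integrable f \<longleftrightarrow> (\<forall>x r. set_integrable M (ball x r) f)"

lemma locally_integrable_bounded:
  assumes "f \<in> borel_measurable M" "\<And>x. \<bar>f x\<bar> \<le> c"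
  shows "locally_integrable f"
  unfolding locally_integrable_def set_integrable_def
proof (intro allI)
  fix x r
  show "integrable M (\<lambda>y. indicator (ball x r) y *\<^sub>R f y)"
    using assms by (intro integrableI_bounded_set_indicator[where B = c]) auto
qed

lemma locally_integrable_integrable: "integrable M f \<Longrightarrow> locally_integrable f"
  unfolding locally_integrable_def set_integrable_def
  using integrable_mult_indicator[of _ M f] by auto

lemma integrable_on_ball:
  assumes f: "locally_integrable f" and g: "g \<in> borel_measurable M"
    and le: "\<And>y. \<bar>g y\<bar> \<le> c * \<bar>f y\<bar> * indicator (ball x r) y"
  shows "integrable M g"
proof (rule Bochner_Integration.integrable_bound[OF _ g])
  show "integrable M (\<lambda>y. c * (indicator (ball x r) y *\<^sub>R f y))"
    using f by (auto simp: locally_integrable_def set_integrable_def)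
  show "AE y in M. norm (g y) \<le> norm (c * (indicator (ball x r) y *\<^sub>R f y))"
  proof (intro AE_I2)
    fix y
    have "\<bar>g y\<bar> \<le> c * \<bar>f y\<bar> * indicator (ball x r) y" by (rule le)
    also have "\<dots> \<le> \<bar>c\<bar> * \<bar>f y\<bar> * indicator (ball x r) y" by (intro mult_right_mono) auto
    finally show "norm (g y) \<le> norm (c * (indicator (ball x r) y *\<^sub>R f y))"
      by (simp add: abs_mult mult.assoc mult.left_commute mult.commute)
  qed
qed

lemma bump_integrable:
  assumes "locally_integrable f" "f \<in> borel_measurable M" "0 < R"
  shows "integrable M (\<lambda>y. bump R x y * f y)"
proof (rule integrable_on_ball[OF assms(1), where c = 1 and x = x and r = "2 * R"])
  show "\<bar>bump R x y * f y\<bar> \<le> 1 * \<bar>f y\<bar> * indicator (ball x (2 * R)) y" for y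
    using bump_eq_0[OF assms(3), of x y] bump_le_1[of R x y]
    by (auto simp: abs_mult indicator_def intro!: mult_left_le_one_le)
qed (use assms in measurable)

text \<open>Here and in \<open>mollify_upper\<close> the cutoff about \<open>x\<close> is compared
  with the indicator of a ball about another centre \<open>z\<close>. Together they transfer
  integrals between neighbouring centres.\<close>

lemma mollify_lower:
  assumes "locally_integrable f" "f \<in> borel_measurable M" "0 < R" "\<And>y. 0 \<le> f y" "dist x z + r \<le> R"
  shows "(LINT y:ball z r|M. f y) \<le> mollify R f x"
  unfolding set_lebesgue_integral_def mollify_def
proof (rule integral_mono)
  fix y
  show "indicator (ball z r) y *\<^sub>R f y \<le> bump R x y * f y"
  proof (cases "y \<in> ball z r")
    case True
    then have "dist x y \<le> R" using assms(5) dist_triangle[of x y z] by auto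
    then show ?thesis using assms(3,4) by (simp add: bump_eq_1 indicator_def)
  qed (use assms in auto)
qed (use assms bump_integrable in \<open>auto simp: locally_integrable_def set_integrable_def\<close>)

lemma mollify_upper:
  assumes "locally_integrable f" "f \<in> borel_measurable M" "0 < R" "\<And>y. 0 \<le> f y" "dist x z + 2 * R \<le> r"
  shows "mollify R f x \<le> (LINT y:ball z r|M. f y)"
  unfolding set_lebesgue_integral_def mollify_def
proof (rule integral_mono)
  fix y
  show "bump R x y * f y \<le> indicator (ball z r) y *\<^sub>R f y"
  proof (cases "y \<in> ball z r")
    case True
    then show ?thesis using assms(4)[of y] bump_le_1[of R x y] by (simp add: mult_left_le_one_le)
  next
    case False
    then have "2 * R \<le> dist x y" using assms(5) dist_triangle[of z y x] by (auto simp: dist_commute)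
    then show ?thesis using assms(3,4) by (simp add: bump_eq_0)
  qed
qed (use assms bump_integrable in \<open>auto simp: locally_integrable_def set_integrable_def\<close>)

lemma mollify_nonneg: "(\<And>y. 0 \<le> f y) \<Longrightarrow> 0 \<le> mollify R f x"
  unfolding mollify_def by (intro integral_nonneg_AE) auto

text \<open>If \<open>dist x x' < R\<close>, the difference of the two cutoffs lives on
  \<open>ball x (3 * R)\<close> and is at most \<open>dist x x' / R\<close> in absolute value. The
  integral of \<open>\<bar>f\<bar>\<close> over that ball therefore controls the increment.\<close>

lemma mollify_continuous:
  assumes f: "locally_integrable f" "f \<in> borel_measurable M" and R: "0 < R"
  shows "continuous_on UNIV (mollify R f)"
proof -
  have "isCont (mollify R f) x" for x
  proof -
    define K where "K = (LINT y:ball x (3 * R)|M. \<bar>f y\<bar>)"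
    have K: "0 \<le> K" unfolding K_def set_lebesgue_integral_def by (intro integral_nonneg_AE) auto
    have bound: "\<bar>mollify R f x - mollify R f x'\<bar> \<le> dist x x' * (K / R)" if "dist x x' < R" for x'
    proof -
      have "\<bar>mollify R f x - mollify R f x'\<bar> = norm (LINT y|M. (bump R x y - bump R x' y) * f y)"
        unfolding mollify_def using bump_integrable[OF f R]
        by (subst Bochner_Integration.integral_diff[symmetric]) (auto simp: left_diff_distrib)
      also have "\<dots> \<le> (LINT y|M. dist x x' / R * (indicator (ball x (3 * R)) y *\<^sub>R \<bar>f y\<bar>))"
      proof (rule order_trans[OF integral_norm_bound], rule integral_mono)
        show "integrable M (\<lambda>y. norm ((bump R x y - bump R x' y) * f y))"
          using bump_integrable[OF f R] by (intro integrable_norm) (simp add: left_diff_distrib)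
        show "integrable M (\<lambda>y. dist x x' / R * (indicator (ball x (3 * R)) y *\<^sub>R \<bar>f y\<bar>))"
          using f by (intro integrable_mult_right) (metis locally_integrable_def set_integrable_abs set_integrable_def)
        fix y
        show "norm ((bump R x y - bump R x' y) * f y) \<le> dist x x' / R * (indicator (ball x (3 * R)) y *\<^sub>R \<bar>f y\<bar>)"
        proof (cases "y \<in> ball x (3 * R)")
          case True
          then show ?thesis using bump_lipschitz[OF R, of x y x']
            by (auto simp: abs_mult intro!: mult_right_mono simp flip: times_divide_eq_left)
        next
          case False
          then have "2 * R \<le> dist x y" "2 * R \<le> dist x' y"
            using that dist_triangle[of x y x'] R by auto
          then show ?thesis using False R by (simp add: bump_eq_0)
        qed
      qed
      also have "\<dots> = dist x x' * (K / R)" by (simp add: K_def set_lebesgue_integral_def)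
      finally show ?thesis .
    qed
    have "((\<lambda>x'. mollify R f x') \<longlongrightarrow> mollify R f x) (at x)"
    proof (rule Lim_transform_bound[where g = "\<lambda>x'. dist x x' * (K / R)", THEN LIM_zero_cancel])
      have "\<forall>\<^sub>F x' in at x. dist x' x < R" using R by (auto simp: eventually_at intro!: exI[of _ R])
      then show "\<forall>\<^sub>F x' in at x. norm (mollify R f x' - mollify R f x) \<le> norm (dist x x' * (K / R))"
        by eventually_elim (use bound K R in \<open>auto simp: abs_minus_commute abs_mult dist_commute\<close>)
      have "((\<lambda>x'. dist x x' * (K / R)) \<longlongrightarrow> dist x x * (K / R)) (at x)"
        by (intro tendsto_intros)
      then show "((\<lambda>x'. dist x x' * (K / R)) \<longlongrightarrow> 0) (at x)" by simp
    qed
    then show ?thesis by (simp add: isCont_def)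
  qed
  then show ?thesis by (simp add: continuous_at_imp_continuous_on)
qed

text \<open>A continuous mean at one fixed scale, not a supremum over radii. Numerator and
  denominator have separate radii, so the region over which \<open>f\<close> is integrated can grow
  while the mass is always taken at scale \<open>R\<close>. For \<open>f \<ge> 0\<close> the summand
  1 makes powers of it increase with the exponent.\<close>

definition maxfun :: "real \<Rightarrow> real \<Rightarrow> ('a \<Rightarrow> real) \<Rightarrow> 'a \<Rightarrow> real" where
  "maxfun T R f x = 1 + mollify T f x / mollify R (\<lambda>_. 1) x"

lemma locally_integrable_1: "locally_integrable (\<lambda>_. 1)"
  by (rule locally_integrable_bounded[where c = 1]) auto

lemma set_integral_1: "(LINT y:ball z r|M. 1) = measure M (ball z r)"
  by (simp add: set_lebesgue_integral_def)

lemma mollify_1_lower: "0 < R \<Longrightarrow> measure M (ball x R) \<le> mollify R (\<lambda>_. 1) x"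
  using mollify_lower[OF locally_integrable_1, of R x x R] by (simp add: set_integral_1)

lemma mollify_1_upper: "0 < R \<Longrightarrow> mollify R (\<lambda>_. 1) x \<le> measure M (ball x (2 * R))"
  using mollify_upper[OF locally_integrable_1, of R x x "2 * R"] by (simp add: set_integral_1)

lemma mollify_1_pos: "0 < R \<Longrightarrow> 0 < mollify R (\<lambda>_. 1) x"
  using mollify_1_lower ball_pos by (meson less_le_trans)

lemma maxfun_ge_1: "0 < R \<Longrightarrow> (\<And>y. 0 \<le> f y) \<Longrightarrow> 1 \<le> maxfun T R f x"
  using mollify_nonneg[of f T x] mollify_1_pos[of R x] by (simp add: maxfun_def)

lemma maxfun_continuous:
  assumes "locally_integrable f" "f \<in> borel_measurable M" "0 < R" "0 < T"
  shows "continuous_on UNIV (maxfun T R f)"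
  unfolding maxfun_def[abs_def]
  using assms mollify_1_pos[OF assms(3)]
  by (intro continuous_intros mollify_continuous locally_integrable_1) (auto simp: less_imp_neq[symmetric])

text \<open>By Fubini: for fixed \<open>y\<close> the inner integral runs over
  \<open>ball y (14 * R)\<close>, where doubling gives
  \<open>1 / ?m x \<le> D / measure M (ball y (14 * R))\<close>, so it is at most
  \<open>D * f y\<close>. As only one scale is involved, this is a strong \<open>L^1\<close> bound,
  which a maximal function would not have.\<close>

lemma maxfun_integral:
  assumes f: "integrable M f" "\<And>y. 0 \<le> f y" and R: "0 < R" and A: "A \<in> sets M"
  shows "(\<integral>\<^sup>+x\<in>A. ennreal (maxfun (7 * R) R f x) \<partial>M) \<le> emeasure M A + ennreal (D * (LINT y|M. f y))"
proof -
  let ?m = "mollify R (\<lambda>_. 1)"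
  have li: "locally_integrable f" and fm [measurable]: "f \<in> borel_measurable M"
    using f locally_integrable_integrable by auto
  have mm [measurable]: "?m \<in> borel_measurable M"
    by (rule continuous_measurable, rule mollify_continuous) (use R locally_integrable_1 in auto)
  have Mm [measurable]: "mollify (7 * R) f \<in> borel_measurable M"
    by (rule continuous_measurable, rule mollify_continuous) (use R li in auto)
  have eq: "ennreal (mollify (7 * R) f x / ?m x) = (\<integral>\<^sup>+y. ennreal (bump (7 * R) x y * f y / ?m x) \<partial>M)" for x
  proof -
    have "(\<integral>\<^sup>+y. ennreal (bump (7 * R) x y * f y / ?m x) \<partial>M) = ennreal (LINT y|M. bump (7 * R) x y * f y / ?m x)"
      using bump_integrable[OF li fm, of "7 * R" x] R f(2) mollify_1_pos[OF R, of x]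
      by (intro nn_integral_eq_integral integrable_divide AE_I2) auto
    then show ?thesis by (simp add: mollify_def)
  qed
  interpret P: pair_sigma_finite M M ..
  have "(\<integral>\<^sup>+x. ennreal (mollify (7 * R) f x / ?m x) \<partial>M)
    = (\<integral>\<^sup>+y. (\<integral>\<^sup>+x. ennreal (bump (7 * R) x y * f y / ?m x) \<partial>M) \<partial>M)"
    unfolding eq by (rule P.Fubini'[symmetric]) (simp add: case_prod_beta')
  also have "\<dots> \<le> (\<integral>\<^sup>+y. ennreal (D * f y) \<partial>M)"
  proof (rule nn_integral_mono)
    fix y
    let ?c = "f y * D / measure M (ball y (14 * R))"
    have "(\<integral>\<^sup>+x. ennreal (bump (7 * R) x y * f y / ?m x) \<partial>M)
      \<le> (\<integral>\<^sup>+x. ennreal ?c * indicator (ball y (14 * R)) x \<partial>M)"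
    proof (rule nn_integral_mono)
      fix x
      show "ennreal (bump (7 * R) x y * f y / ?m x) \<le> ennreal ?c * indicator (ball y (14 * R)) x"
      proof (cases "x \<in> ball y (14 * R)")
        case True
        have B: "measure M (ball y (14 * R)) \<le> D * measure M (ball x R)"
          using True R by (intro measure_ball_le_D) (auto simp: dist_commute)
        also have "\<dots> \<le> D * ?m x" using mollify_1_lower[OF R, of x] D_ge_1 by simp
        finally have "1 / ?m x \<le> D / measure M (ball y (14 * R))"
          using ball_pos[of "14 * R" y] mollify_1_pos[OF R, of x] R by (simp add: field_simps)
        moreover have "bump (7 * R) x y * f y \<le> f y"
          using bump_le_1[of "7 * R" x y] f(2)[of y] by (simp add: mult_left_le_one_le)
        ultimately have "(bump (7 * R) x y * f y) * (1 / ?m x) \<le> f y * (D / measure M (ball y (14 * R)))"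
          using f(2)[of y] mollify_1_pos[OF R, of x] by (intro mult_mono) auto
        then show ?thesis using True by (auto intro: ennreal_leI)
      next
        case False
        then show ?thesis using R by (simp add: bump_eq_0 dist_commute)
      qed
    qed
    also have "\<dots> = ennreal ?c * emeasure M (ball y (14 * R))"
      by (simp add: nn_integral_cmult_indicator)
    also have "\<dots> = ennreal (D * f y)"
      using ball_pos[of "14 * R" y] R f(2)[of y] D_ge_1 by (simp add: ball_emeasure flip: ennreal_mult)
    finally show "(\<integral>\<^sup>+x. ennreal (bump (7 * R) x y * f y / ?m x) \<partial>M) \<le> ennreal (D * f y)" .
  qed
  also have "\<dots> = ennreal (D * (LINT y|M. f y))"
    using f D_ge_1 by (subst nn_integral_eq_integral) auto
  finally have *: "(\<integral>\<^sup>+x. ennreal (mollify (7 * R) f x / ?m x) \<partial>M) \<le> ennreal (D * (LINT y|M. f y))" .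
  have "(\<integral>\<^sup>+x\<in>A. ennreal (maxfun (7 * R) R f x) \<partial>M)
    \<le> (\<integral>\<^sup>+x. indicator A x + ennreal (mollify (7 * R) f x / ?m x) \<partial>M)"
  proof (rule nn_integral_mono)
    fix x
    show "ennreal (maxfun (7 * R) R f x) * indicator A x \<le> indicator A x + ennreal (mollify (7 * R) f x / ?m x)"
      using mollify_nonneg[of f "7 * R" x] f(2) mollify_1_pos[OF R, of x]
      by (cases "x \<in> A") (auto simp: maxfun_def)
  qed
  also have "\<dots> = emeasure M A + (\<integral>\<^sup>+x. ennreal (mollify (7 * R) f x / ?m x) \<partial>M)"
    using A by (subst nn_integral_add) auto
  also have "\<dots> \<le> emeasure M A + ennreal (D * (LINT y|M. f y))" using * by (rule add_left_mono)
  finally show ?thesis .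
qed

end

section \<open>Approximation at a fixed scale\<close>

text \<open>In the application \<open>b = 1/\<tau>\<close>, and \<open>F\<close> stands for the
  \<open>\<tau>\<close>-th power of a gradient, so that it is integrable also when
  \<open>\<tau> < 1\<close>. The bound 2 is chosen to exceed \<open>pi/2\<close>, the bound of
  \<open>arctan\<close>.\<close>

locale scale_estimate = doubling_space +
  fixes u F :: "'a \<Rightarrow> real" and N :: "'a set" and \<rho> s b :: real
  assumes u_meas [measurable]: "u \<in> borel_measurable M" and u_le: "\<And>x. \<bar>u x\<bar> \<le> 2"
    and F_int: "integrable M F" and F_nonneg: "\<And>x. 0 \<le> F x"
    and N_null: "N \<in> null_sets M" and rho: "0 < \<rho>" and b: "0 < b"
    and osc: "\<And>x y. x \<notin> N \<Longrightarrow> y \<notin> N \<Longrightarrow> dist x y < \<rho> \<Longrightarrow>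
      \<bar>u x - u y\<bar> \<le> \<rho> powr s * (F x powr b + F y powr b)"
begin

text \<open>Two points at distance less than \<open>3 * R\<close> from a third one are less than
  \<open>6 * R < \<rho>\<close> apart, so \<open>osc\<close> applies to them.\<close>

definition R :: real where "R = \<rho> / 8"

lemma R: "0 < R" using rho by (simp add: R_def)

lemma F_meas [measurable]: "F \<in> borel_measurable M" using F_int by simp

lemma F_loc: "locally_integrable F" using F_int by (rule locally_integrable_integrable)

definition H :: "'a \<Rightarrow> real" where "H = maxfun (7 * R) R F"

text \<open>If \<open>\<tau> < 1\<close>, then \<open>F^b\<close> need not be locally integrable, so averages of \<open>u\<close> are taken only
  over the points where \<open>F\<close> is controlled by its mean.\<close>

definition good :: "'a set" where "good = {y. F y \<le> 2 * D * maxfun (2 * R) R F y}"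

lemma H_ge_1: "1 \<le> H x"
  unfolding H_def by (rule maxfun_ge_1[OF R F_nonneg])

lemma H_continuous: "continuous_on UNIV H"
  unfolding H_def by (rule maxfun_continuous) (use R F_loc in auto)

lemma good_sets [measurable]: "good \<in> sets M"
proof -
  have [measurable]: "maxfun (2 * R) R F \<in> borel_measurable M"
    by (rule continuous_measurable, rule maxfun_continuous) (use R F_loc in auto)
  have "{y \<in> space M. F y \<le> 2 * D * maxfun (2 * R) R F y} \<in> sets M" by measurable
  then show ?thesis by (simp add: good_def)
qed

text \<open>This explains the radius \<open>7 * R\<close> in \<open>H\<close>: the cutoff of radius
  \<open>2 * R\<close> at \<open>y\<close> vanishes outside \<open>ball y (4 * R)\<close>, which
  lies in \<open>ball x (7 * R)\<close>. One value \<open>H x\<close> thus controls \<open>F\<close>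
  at all good points near \<open>x\<close>. One factor \<open>D\<close> comes from
  \<open>good\<close>, the other from comparing the masses at \<open>x\<close> and
  \<open>y\<close>.\<close>

lemma F_le_H:
  assumes "dist x y < 3 * R" "y \<in> good"
  shows "F y \<le> 2 * D\<^sup>2 * H x"
proof -
  let ?m = "mollify R (\<lambda>_. 1)"
  have 1: "mollify (2 * R) F y \<le> (LINT z:ball x (7 * R)|M. F z)"
    using assms R by (intro mollify_upper F_loc F_nonneg F_meas) (auto simp: dist_commute)
  have 2: "(LINT z:ball x (7 * R)|M. F z) \<le> mollify (7 * R) F x"
    using R by (intro mollify_lower F_loc F_nonneg F_meas) auto
  have "?m x \<le> measure M (ball x (2 * R))" by (rule mollify_1_upper[OF R])
  also have "\<dots> \<le> D * measure M (ball y R)"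
    using assms R by (intro measure_ball_le_D) (auto simp: dist_commute)
  also have "\<dots> \<le> D * ?m y" using mollify_1_lower[OF R, of y] D_ge_1 by simp
  finally have "1 / ?m y \<le> D / ?m x"
    using mollify_1_pos[OF R, of x] mollify_1_pos[OF R, of y] by (simp add: field_simps)
  then have "mollify (2 * R) F y * (1 / ?m y) \<le> mollify (7 * R) F x * (D / ?m x)"
    using 1 2 mollify_1_pos[OF R, of y] mollify_nonneg[of F "7 * R" x] F_nonneg by (intro mult_mono) auto
  then have "maxfun (2 * R) R F y \<le> D * H x"
    using D_ge_1 by (simp add: maxfun_def H_def algebra_simps)
  then have "2 * D * maxfun (2 * R) R F y \<le> 2 * D * (D * H x)"
    using D_ge_1 by (intro mult_left_mono) auto
  then show ?thesis using assms(2) by (simp add: good_def power2_eq_square)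
qed

text \<open>Chebyshev's inequality. At bad points of \<open>ball x R\<close> the value of
  \<open>F\<close> is at least \<open>l\<close>, hence at least twice its mean over the ball, so
  they fill at most half of it. In the factor \<open>2 * D\<close> of \<open>good\<close>,
  \<open>D\<close> pays for the change of centre and 2 for the half; the summand
  \<open>2 * D\<close> of \<open>l\<close> keeps \<open>l\<close> positive when \<open>F\<close>
  vanishes on the ball.\<close>

lemma measure_good: "measure M (ball x R) \<le> 2 * measure M (ball x R \<inter> good)"
proof -
  define \<mu> I l where "\<mu> = measure M (ball x R)" and "I = (LINT y:ball x R|M. F y)" and "l = 2 * D + 2 * (I / \<mu>)"
  let ?m = "mollify R (\<lambda>_. 1)"
  have \<mu>: "0 < \<mu>" using ball_pos[OF R] by (simp add: \<mu>_def)
  have I: "0 \<le> I" unfolding I_def set_lebesgue_integral_def using F_nonneg by (intro integral_nonneg_AE) auto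
  have l: "0 < l" using I \<mu> D_ge_1 by (simp add: l_def add_pos_nonneg)
  have bad: "l \<le> F y" if "y \<in> ball x R - good" for y
  proof -
    have dxy: "dist x y < R" using that by auto
    have 1: "I \<le> mollify (2 * R) F y"
      unfolding I_def using R dxy by (intro mollify_lower F_loc F_nonneg F_meas) (auto simp: dist_commute)
    have "?m y \<le> measure M (ball y (2 * R))" by (rule mollify_1_upper[OF R])
    also have "\<dots> \<le> D * \<mu>"
      unfolding \<mu>_def using dxy R by (intro measure_ball_le_D) auto
    finally have "1 / \<mu> \<le> D / ?m y"
      using mollify_1_pos[OF R, of y] \<mu> by (simp add: field_simps)
    then have "I * (1 / \<mu>) \<le> mollify (2 * R) F y * (D / ?m y)"
      using 1 I \<mu> by (intro mult_mono) auto
    moreover have "l = 2 * D + 2 * (I * (1 / \<mu>))" by (simp add: l_def)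
    moreover have "2 * D * maxfun (2 * R) R F y = 2 * D + 2 * (mollify (2 * R) F y * (D / ?m y))"
      by (simp add: maxfun_def algebra_simps)
    ultimately have "l \<le> 2 * D * maxfun (2 * R) R F y" by linarith
    then show ?thesis using that by (simp add: good_def)
  qed
  have fin: "emeasure M (ball x R - good) < \<infinity>"
    using emeasure_mono[of "ball x R - good" "ball x R" M] ball_finite(1)[of x R]
    by (auto intro: order_le_less_trans)
  have "l * measure M (ball x R - good) = (LINT y|M. l * indicator (ball x R - good) y)"
    by simp
  also have "\<dots> \<le> I"
    unfolding I_def set_lebesgue_integral_def
  proof (rule integral_mono)
    show "integrable M (\<lambda>y. l * indicator (ball x R - good) y)"
      using fin by (auto intro!: integrable_mult_right integrable_real_indicator)
    show "integrable M (\<lambda>y. indicator (ball x R) y *\<^sub>R F y)"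
      using F_loc by (simp add: locally_integrable_def set_integrable_def)
    show "l * indicator (ball x R - good) y \<le> indicator (ball x R) y *\<^sub>R F y" for y
      using bad[of y] F_nonneg[of y] by (auto simp: indicator_def)
  qed
  also have "\<dots> \<le> l * (\<mu> / 2)"
    using \<mu> D_ge_1 by (simp add: l_def field_simps)
  finally have "measure M (ball x R - good) \<le> \<mu> / 2" using l by simp
  moreover have "\<mu> = measure M (ball x R \<inter> good) + measure M (ball x R - good)"
  proof -
    have "measure M (ball x R - (ball x R \<inter> good)) = \<mu> - measure M (ball x R \<inter> good)"
      unfolding \<mu>_def by (rule measure_Diff) auto
    moreover have "ball x R - (ball x R \<inter> good) = ball x R - good" by auto
    ultimately show ?thesis by simp
  qed
  ultimately show ?thesis by (simp add: \<mu>_def)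
qed

section \<open>Weighted means over good points and their slope\<close>

definition weight :: "'a \<Rightarrow> 'a \<Rightarrow> real" where
  "weight x y = bump R x y * indicator good y"

definition mass :: "'a \<Rightarrow> real" where "mass x = (LINT y|M. weight x y)"

text \<open>The indicator of \<open>good\<close> inside \<open>weight\<close> does not depend on the
  centre \<open>x\<close>. All dependence on \<open>x\<close> comes from the Lipschitz cutoff, so
  the mean varies continuously although \<open>good\<close> is merely measurable.\<close>

definition smooth :: "'a \<Rightarrow> real" where "smooth x = (LINT y|M. weight x y * u y) / mass x"

lemma weight_integrable_mult:
  assumes "f \<in> borel_measurable M" "\<And>y. \<bar>f y\<bar> \<le> c"
  shows "integrable M (\<lambda>y. weight x y * f y)"
proof -
  have "0 \<le> c" using assms(2)[of undefined] by linarith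
  then have "locally_integrable (\<lambda>y. indicator good y * f y)"
    using assms by (intro locally_integrable_bounded[where c = c]) (auto simp: indicator_def)
  then have "integrable M (\<lambda>y. bump R x y * (indicator good y * f y))"
    using assms by (intro bump_integrable R) auto
  then show ?thesis by (simp add: weight_def mult.assoc)
qed

lemma weight_integrable: "integrable M (weight x)"
  using weight_integrable_mult[of "\<lambda>_. 1" 1 x] by simp

lemma weight_nonneg: "0 \<le> weight x y" by (simp add: weight_def)

lemma weight_measurable [measurable]: "weight x \<in> borel_measurable M"
  unfolding weight_def[abs_def] by measurable

lemma mass_lower: "measure M (ball x R) \<le> 2 * mass x"
proof -
  have "measure M (ball x R \<inter> good) = (LINT y|M. indicator (ball x R \<inter> good) y)" by simp
  also have "\<dots> \<le> mass x"
    unfolding mass_def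
  proof (rule integral_mono[OF _ weight_integrable])
    have "emeasure M (ball x R \<inter> good) < \<infinity>"
      using emeasure_mono[of "ball x R \<inter> good" "ball x R" M] ball_finite(1)[of x R]
      by (auto intro: order_le_less_trans)
    then show "integrable M (indicator (ball x R \<inter> good) :: 'a \<Rightarrow> real)"
      by (intro integrable_real_indicator) auto
    show "indicator (ball x R \<inter> good) y \<le> weight x y" for y
      using R by (auto simp: weight_def indicator_def bump_eq_1)
  qed
  finally show ?thesis using measure_good[of x] by simp
qed

lemma mass_pos: "0 < mass x"
  using mass_lower[of x] ball_pos[OF R, of x] by simp

lemma weight_mean: "(LINT y|M. weight x y * (u y - c)) = mass x * (smooth x - c)"
proof -
  have "(LINT y|M. weight x y * (u y - c)) = (LINT y|M. weight x y * u y) - c * mass x"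
    using weight_integrable_mult[OF u_meas u_le, of x] weight_integrable[of x]
    by (simp add: right_diff_distrib mass_def)
  moreover have "(LINT y|M. weight x y * u y) = mass x * smooth x"
    using mass_pos[of x] by (simp add: smooth_def)
  ultimately show ?thesis by (simp add: right_diff_distrib)
qed

text \<open>Used with \<open>c = 0\<close> for boundedness, with \<open>c = u x\<close> for the
  approximation error, and with \<open>c = u y\<close> for the slope.\<close>

lemma smooth_average:
  assumes "AE y in M. y \<in> good \<longrightarrow> dist x y < 2 * R \<longrightarrow> \<bar>u y - c\<bar> \<le> e"
  shows "\<bar>smooth x - c\<bar> \<le> e"
proof -
  have int: "integrable M (\<lambda>y. weight x y * (u y - c))"
    by (rule weight_integrable_mult[where c = "2 + \<bar>c\<bar>"])
      (auto intro!: order_trans[OF abs_triangle_ineq4] u_le)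
  have "mass x * \<bar>smooth x - c\<bar> = \<bar>LINT y|M. weight x y * (u y - c)\<bar>"
    using mass_pos[of x] by (simp add: weight_mean abs_mult)
  also have "\<dots> \<le> (LINT y|M. norm (weight x y * (u y - c)))"
    using integral_norm_bound[of M "\<lambda>y. weight x y * (u y - c)"] by simp
  also have "\<dots> \<le> (LINT y|M. e * weight x y)"
  proof (rule integral_mono_AE)
    show "integrable M (\<lambda>y. norm (weight x y * (u y - c)))" using int by (rule integrable_norm)
    show "integrable M (\<lambda>y. e * weight x y)" using weight_integrable by simp
    show "AE y in M. norm (weight x y * (u y - c)) \<le> e * weight x y"
      using assms
    proof eventually_elim
      case (elim y)
      show ?case
      proof (cases "y \<in> good \<and> dist x y < 2 * R")
        case True
        then have "\<bar>u y - c\<bar> \<le> e" using elim by simp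
        then have "weight x y * \<bar>u y - c\<bar> \<le> weight x y * e" using weight_nonneg by (rule mult_left_mono)
        then show ?thesis using weight_nonneg[of x y] by (simp add: abs_mult mult.commute)
      next
        case False
        then have "weight x y = 0" using R by (auto simp: weight_def bump_eq_0)
        then show ?thesis by simp
      qed
    qed
  qed
  also have "\<dots> = mass x * e" by (simp add: mass_def)
  finally show ?thesis using mass_pos[of x] by simp
qed

lemma smooth_le: "\<bar>smooth x\<bar> \<le> 2"
  using smooth_average[of x 0 2] u_le by simp

lemma AE_not_N: "AE y in M. y \<notin> N"
  using N_null by (rule AE_not_in)

lemma osc_good:
  assumes "y \<in> good" "z \<in> good" "y \<notin> N" "z \<notin> N" "dist x y < 3 * R" "dist x z < 3 * R"
  shows "\<bar>u y - u z\<bar> \<le> 2 * \<rho> powr s * (2 * D\<^sup>2 * H x) powr b"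
proof -
  have "dist y z < \<rho>" using assms(5,6) dist_triangle[of y z x] R by (simp add: R_def dist_commute)
  then have "\<bar>u y - u z\<bar> \<le> \<rho> powr s * (F y powr b + F z powr b)"
    using osc assms by simp
  also have "\<dots> \<le> \<rho> powr s * ((2 * D\<^sup>2 * H x) powr b + (2 * D\<^sup>2 * H x) powr b)"
    using F_le_H[OF assms(5,1)] F_le_H[OF assms(6,2)] F_nonneg b
    by (intro mult_left_mono add_mono powr_mono2) auto
  finally show ?thesis by (simp add: algebra_simps)
qed

text \<open>The point \<open>x\<close> need not be good, so \<open>F x\<close> cannot be replaced by
  \<open>H x\<close> and stays in the bound; \<open>smooth_diff_le\<close> deals with it.\<close>

lemma smooth_approx:
  assumes "x \<notin> N"
  shows "\<bar>smooth x - u x\<bar> \<le> \<rho> powr s * (F x powr b + (2 * D\<^sup>2 * H x) powr b)"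
proof (rule smooth_average)
  show "AE y in M. y \<in> good \<longrightarrow> dist x y < 2 * R \<longrightarrow>
    \<bar>u y - u x\<bar> \<le> \<rho> powr s * (F x powr b + (2 * D\<^sup>2 * H x) powr b)"
    using AE_not_N
  proof eventually_elim
    case (elim y)
    show ?case
    proof (intro impI)
      assume y: "y \<in> good" "dist x y < 2 * R"
      have "\<bar>u x - u y\<bar> \<le> \<rho> powr s * (F x powr b + F y powr b)"
        using osc[OF assms elim] y R by (simp add: R_def)
      also have "\<dots> \<le> \<rho> powr s * (F x powr b + (2 * D\<^sup>2 * H x) powr b)"
        using F_le_H[of x y] y R F_nonneg b
        by (intro mult_left_mono add_mono powr_mono2) auto
      finally show "\<bar>u y - u x\<bar> \<le> \<rho> powr s * (F x powr b + (2 * D\<^sup>2 * H x) powr b)"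
        by (simp add: abs_minus_commute)
    qed
  qed
qed

text \<open>The factor \<open>32 * D\<close> is the product of 8 from \<open>1/R = 8/\<rho>\<close>,
  2 from \<open>osc_good\<close>, and \<open>2 * D\<close>, which bounds the ratio of
  \<open>measure M (ball x (3 * R))\<close> to \<open>mass x\<close>.\<close>

definition slope_const :: real where "slope_const = 32 * D * (2 * D\<^sup>2) powr b"

definition slope :: "'a \<Rightarrow> real" where "slope x = slope_const * \<rho> powr (s - 1) * H x powr b"

text \<open>After subtracting the constant \<open>smooth x'\<close> from \<open>u\<close>, the
  integral against \<open>weight x'\<close> vanishes. Only the difference of the two weights is left
  to estimate, and \<open>mass x\<close> and \<open>mass x'\<close> need not be compared.\<close>

lemma smooth_slope:
  assumes "dist x x' < R"
  shows "\<bar>smooth x - smooth x'\<bar> \<le> dist x x' * slope x"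
proof -
  define e where "e = 2 * \<rho> powr s * (2 * D\<^sup>2 * H x) powr b"
  define B where "B = ball x (3 * R)"
  have e: "0 \<le> e" by (simp add: e_def)
  \<comment> \<open>Averaging \<open>osc_good\<close> over the points \<open>z\<close> seen from
    \<open>x'\<close> replaces \<open>u z\<close> by \<open>smooth x'\<close>. All these points lie
    within \<open>3 * R\<close> of \<open>x\<close>, so the bound involves \<open>H\<close> at
    \<open>x\<close> alone.\<close>
  have close: "AE y in M. y \<in> good \<longrightarrow> y \<in> B \<longrightarrow> \<bar>u y - smooth x'\<bar> \<le> e"
    using AE_not_N
  proof eventually_elim
    case (elim y)
    show ?case
    proof (intro impI)
      assume y: "y \<in> good" "y \<in> B"
      have "\<bar>smooth x' - u y\<bar> \<le> e"
      proof (rule smooth_average)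
        show "AE z in M. z \<in> good \<longrightarrow> dist x' z < 2 * R \<longrightarrow> \<bar>u z - u y\<bar> \<le> e"
          using AE_not_N
        proof eventually_elim
          case (elim z)
          show ?case
          proof (intro impI)
            assume z: "z \<in> good" "dist x' z < 2 * R"
            have "dist x z < 3 * R" using dist_triangle[of x z x'] assms z by simp
            then show "\<bar>u z - u y\<bar> \<le> e"
              unfolding e_def using y z elim \<open>y \<notin> N\<close> by (intro osc_good) (auto simp: B_def)
          qed
        qed
      qed
      then show "\<bar>u y - smooth x'\<bar> \<le> e" by (simp add: abs_minus_commute)
    qed
  qed
  have int: "integrable M (\<lambda>y. weight z y * (u y - smooth x'))" for z
    by (rule weight_integrable_mult[where c = "2 + \<bar>smooth x'\<bar>"])
      (auto intro!: order_trans[OF abs_triangle_ineq4] u_le)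
  have "mass x * \<bar>smooth x - smooth x'\<bar> = \<bar>LINT y|M. weight x y * (u y - smooth x')\<bar>"
    using mass_pos[of x] by (simp add: weight_mean abs_mult)
  also have "\<dots> = \<bar>LINT y|M. weight x y * (u y - smooth x') - weight x' y * (u y - smooth x')\<bar>"
    using int by (simp add: weight_mean[of x' "smooth x'"])
  also have "\<dots> \<le> (LINT y|M. norm (weight x y * (u y - smooth x') - weight x' y * (u y - smooth x')))"
    using integral_norm_bound[of M "\<lambda>y. weight x y * (u y - smooth x') - weight x' y * (u y - smooth x')"] by simp
  also have "\<dots> \<le> (LINT y|M. dist x x' / R * e * indicator B y)"
  proof (rule integral_mono_AE)
    show "integrable M (\<lambda>y. norm (weight x y * (u y - smooth x') - weight x' y * (u y - smooth x')))"
      using int by (intro integrable_norm Bochner_Integration.integrable_diff)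
    show "integrable M (\<lambda>y. dist x x' / R * e * indicator B y)"
      unfolding B_def by (intro integrable_mult_right integrable_real_indicator) auto
    show "AE y in M. norm (weight x y * (u y - smooth x') - weight x' y * (u y - smooth x'))
        \<le> dist x x' / R * e * indicator B y"
      using close
    proof eventually_elim
      case (elim y)
      have eq: "weight x y * (u y - smooth x') - weight x' y * (u y - smooth x')
        = (bump R x y - bump R x' y) * indicator good y * (u y - smooth x')"
        by (simp add: weight_def algebra_simps)
      show ?case
      proof (cases "y \<in> good \<and> y \<in> B")
        case True
        then show ?thesis
          using bump_lipschitz[OF R, of x y x'] elim R unfolding eq
          by (auto simp: abs_mult simp del: times_divide_eq_left times_divide_eq_right intro!: mult_mono)
      next
        case False
        have "bump R x y = bump R x' y" if "y \<notin> B"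
        proof -
          have "2 * R \<le> dist x y" "2 * R \<le> dist x' y"
            using that assms dist_triangle[of x y x'] R by (auto simp: B_def)
          then show ?thesis using R by (simp add: bump_eq_0)
        qed
        then have z: "(bump R x y - bump R x' y) * indicator good y = 0" using False by auto
        show ?thesis unfolding eq z using e R by simp
      qed
    qed
  qed
  also have "\<dots> = dist x x' / R * e * measure M B" by (simp add: B_def)
  also have "\<dots> \<le> dist x x' / R * e * (2 * D * mass x)"
  proof (rule mult_left_mono)
    have "measure M B \<le> D * measure M (ball x R)"
      unfolding B_def using R by (intro measure_ball_le_D) auto
    also have "\<dots> \<le> D * (2 * mass x)" using mass_lower[of x] D_ge_1 by (intro mult_left_mono) auto
    finally show "measure M B \<le> 2 * D * mass x" by simp
    show "0 \<le> dist x x' / R * e" using e R by simp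
  qed
  finally have "mass x * \<bar>smooth x - smooth x'\<bar> \<le> mass x * (dist x x' / R * e * (2 * D))"
    by (simp add: algebra_simps)
  then have "\<bar>smooth x - smooth x'\<bar> \<le> dist x x' / R * e * (2 * D)"
    using mass_pos[of x] by (rule mult_left_le_imp_le)
  also have "\<dots> = dist x x' * slope x"
  proof -
    have "\<rho> powr s = \<rho> * \<rho> powr (s - 1)" using rho by (simp add: powr_diff)
    moreover have "(2 * D\<^sup>2 * H x) powr b = (2 * D\<^sup>2) powr b * H x powr b"
      by (rule powr_mult)
    ultimately show ?thesis using rho by (simp add: e_def R_def slope_def slope_const_def field_simps)
  qed
  finally show ?thesis .
qed

lemma slope_const_pos: "0 < slope_const"
  using D_ge_1 by (auto simp: slope_const_def)

lemma slope_bound: "local_slope_bound smooth slope"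
  unfolding local_slope_bound_def
proof (intro conjI allI exI[of _ R] impI)
  have "H x \<noteq> 0" for x using H_ge_1[of x] by linarith
  then show "continuous_on UNIV slope"
    unfolding slope_def[abs_def] by (auto intro!: continuous_intros H_continuous)
  show "0 \<le> slope x" for x using slope_const_pos by (simp add: slope_def)
qed (use R smooth_slope in auto)

end

section \<open>Size of the slope and of the approximation error\<close>

context scale_estimate
begin

text \<open>The total integral of \<open>F\<close> is divided by a mass of at least
  \<open>c * R powr n\<close>; \<open>R = \<rho> / 8\<close> produces \<open>8 powr n\<close>, and
  \<open>\<rho> \<le> 1\<close> lets the summand 1 of \<open>maxfun\<close> be absorbed into
  \<open>\<rho> powr - n\<close>.\<close>

lemma H_upper:
  assumes c: "0 < c" "\<And>t. 0 < t \<Longrightarrow> t \<le> r0 \<Longrightarrow> c * t powr n \<le> measure M (ball x t)"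
    and \<rho>: "\<rho> \<le> 1" "\<rho> \<le> 8 * r0" and K: "(LINT y|M. F y) \<le> K"
  shows "H x \<le> (1 + K * 8 powr n / c) * \<rho> powr - n"
proof -
  have I0: "0 \<le> (LINT y|M. F y)" using F_nonneg by (intro integral_nonneg_AE) auto
  have "mollify (7 * R) F x \<le> (LINT y|M. F y)"
    unfolding mollify_def using R bump_integrable[OF F_loc F_meas] F_int F_nonneg bump_le_1
    by (intro integral_mono) (auto intro: mult_left_le_one_le)
  then have 1: "mollify (7 * R) F x \<le> K" using K by simp
  have "c * R powr n \<le> measure M (ball x R)"
    using c(2)[of R] R \<rho> by (simp add: R_def)
  also have "\<dots> \<le> mollify R (\<lambda>_. 1) x" by (rule mollify_1_lower[OF R])
  finally have 2: "c * R powr n \<le> mollify R (\<lambda>_. 1) x" .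
  have cR: "0 < c * R powr n" using c R by simp
  have "H x \<le> 1 + K / (c * R powr n)"
    unfolding H_def maxfun_def using 1 2 cR I0 K by (intro add_left_mono frac_le) auto
  also have "K / (c * R powr n) = K * 8 powr n / c * \<rho> powr - n"
    using rho c by (simp add: R_def powr_divide powr_minus field_simps)
  also have "1 \<le> \<rho> powr - n"
    using rho \<rho> n by (simp add: powr_minus one_le_inverse powr_le1)
  finally show ?thesis by (simp add: algebra_simps)
qed

text \<open>Prepares the \<open>L^1\<close> estimate: one factor \<open>H\<close> is kept, since its
  integral is bounded, and the others are replaced by the pointwise bound. Raising the exponent from
  \<open>b\<close> to \<open>a \<ge> 1\<close> ensures that there is a factor to keep; this is
  allowed because \<open>H \<ge> 1\<close>.\<close>

lemma slope_le:
  assumes H: "H x \<le> A * \<rho> powr - n" and a: "1 \<le> a" "b \<le> a"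
  shows "slope x \<le> slope_const * A powr (a - 1) * \<rho> powr (s - 1 - n * (a - 1)) * H x"
proof -
  have H1: "1 \<le> H x" by (rule H_ge_1)
  have "0 < A * \<rho> powr - n" using H H1 by linarith
  then have A: "0 < A" using rho by (simp add: zero_less_mult_iff)
  have "H x powr b \<le> H x powr a" using H1 a by (intro powr_mono) auto
  also have "\<dots> = H x powr (a - 1) * H x" using H1 by (simp add: powr_diff)
  also have "\<dots> \<le> (A * \<rho> powr - n) powr (a - 1) * H x"
    using H H1 a by (intro mult_right_mono powr_mono2) auto
  also have "(A * \<rho> powr - n) powr (a - 1) = A powr (a - 1) * \<rho> powr (- n * (a - 1))"
    using A rho by (simp add: powr_mult powr_powr)
  finally have "slope x \<le> slope_const * \<rho> powr (s - 1) * (A powr (a - 1) * \<rho> powr (- n * (a - 1)) * H x)"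
    unfolding slope_def using slope_const_pos by (intro mult_left_mono) auto
  also have "\<dots> = slope_const * A powr (a - 1) * (\<rho> powr (s - 1) * \<rho> powr (- n * (a - 1))) * H x"
    by simp
  also have "\<rho> powr (s - 1) * \<rho> powr (- n * (a - 1)) = \<rho> powr (s - 1 - n * (a - 1))"
    by (simp add: powr_add[symmetric])
  finally show ?thesis .
qed

text \<open>The critical computation: \<open>n * (b * p - 1) = (s - 1) * p\<close>, so the powers of
  \<open>\<rho>\<close> cancel and a bound free of \<open>\<rho>\<close> remains once a single
  factor \<open>H\<close> is kept.\<close>

lemma slope_power_le:
  assumes H: "H x \<le> A * \<rho> powr - n" and p: "0 < p" and bp: "b * p - 1 = p * (s - 1) / n" and s: "1 < s"
  shows "slope x powr p \<le> slope_const powr p * A powr (b * p - 1) * H x"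
proof -
  have H1: "1 \<le> H x" by (rule H_ge_1)
  have "0 < A * \<rho> powr - n" using H H1 by linarith
  then have A: "0 < A" using rho by (simp add: zero_less_mult_iff)
  have bp0: "0 \<le> b * p - 1" unfolding bp using p s n by simp
  have "slope x powr p = slope_const powr p * \<rho> powr ((s - 1) * p) * H x powr (b * p)"
    unfolding slope_def using slope_const_pos H1 rho by (simp add: powr_mult powr_powr)
  also have "H x powr (b * p) = H x powr (b * p - 1) * H x" using H1 by (simp add: powr_diff)
  also have "slope_const powr p * \<rho> powr ((s - 1) * p) * (H x powr (b * p - 1) * H x)
    \<le> slope_const powr p * \<rho> powr ((s - 1) * p) * ((A * \<rho> powr - n) powr (b * p - 1) * H x)"
    using H H1 bp0 by (intro mult_left_mono mult_right_mono powr_mono2) auto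
  also have "(A * \<rho> powr - n) powr (b * p - 1) = A powr (b * p - 1) * \<rho> powr (- ((s - 1) * p))"
    using A rho n unfolding bp by (simp add: powr_mult powr_powr mult.commute)
  also have "slope_const powr p * \<rho> powr ((s - 1) * p) * (A powr (b * p - 1) * \<rho> powr (- ((s - 1) * p)) * H x)
    = slope_const powr p * A powr (b * p - 1) * (\<rho> powr ((s - 1) * p) * \<rho> powr (- ((s - 1) * p))) * H x"
    by simp
  also have "\<rho> powr ((s - 1) * p) * \<rho> powr (- ((s - 1) * p)) = 1"
    using rho by (simp add: powr_add[symmetric])
  finally show ?thesis by simp
qed

text \<open>If \<open>b > 1\<close>, the term \<open>F x powr b\<close> may fail to be integrable,
  so it is cut at the level \<open>\<rho> powr (- s / (2 * b))\<close>. Below it,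
  \<open>\<rho> powr s * F x powr b\<close> is at most \<open>\<rho> powr (s / 2)\<close>; above it,
  the trivial bound 4 is dominated by a small multiple of \<open>F x\<close>.\<close>

lemma smooth_diff_le:
  assumes x: "x \<notin> N" and \<rho>: "\<rho> \<le> 1"
  shows "\<bar>smooth x - u x\<bar> \<le> \<rho> powr (s / 2) + 4 * \<rho> powr (s / (2 * b)) * F x + slope x"
proof -
  have sl: "\<rho> powr s * (2 * D\<^sup>2 * H x) powr b \<le> slope x"
  proof -
    have "\<rho> powr s * (2 * D\<^sup>2 * H x) powr b = \<rho> * \<rho> powr (s - 1) * ((2 * D\<^sup>2) powr b * H x powr b)"
      using rho H_ge_1[of x] by (simp add: powr_diff powr_mult)
    also have "\<dots> = \<rho> * ((2 * D\<^sup>2) powr b * \<rho> powr (s - 1) * H x powr b)" by simp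
    also have "\<dots> \<le> 1 * (slope_const * \<rho> powr (s - 1) * H x powr b)"
    proof -
      have "1 * (2 * D\<^sup>2) powr b \<le> (32 * D) * (2 * D\<^sup>2) powr b"
        using D_ge_1 by (intro mult_right_mono) auto
      then show ?thesis
        using \<rho> rho by (intro mult_mono mult_right_mono) (auto simp: slope_const_def)
    qed
    finally show ?thesis by (simp add: slope_def)
  qed
  have nn: "0 \<le> slope x" using slope_const_pos by (simp add: slope_def)
  show ?thesis
  proof (cases "F x \<le> \<rho> powr (- s / (2 * b))")
    case True
    have "F x powr b \<le> (\<rho> powr (- s / (2 * b))) powr b"
      using True F_nonneg b by (intro powr_mono2) auto
    also have "\<dots> = \<rho> powr (- s / 2)" using b by (simp add: powr_powr)
    finally have "\<rho> powr s * F x powr b \<le> \<rho> powr s * \<rho> powr (- s / 2)" by (intro mult_left_mono) auto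
    also have "\<dots> = \<rho> powr (s / 2)" by (simp add: powr_add[symmetric])
    finally have "\<rho> powr s * F x powr b \<le> \<rho> powr (s / 2)" .
    moreover have "\<bar>smooth x - u x\<bar> \<le> \<rho> powr s * F x powr b + \<rho> powr s * (2 * D\<^sup>2 * H x) powr b"
      using smooth_approx[OF x] by (simp add: distrib_left)
    moreover have "0 \<le> 4 * \<rho> powr (s / (2 * b)) * F x" using F_nonneg by simp
    ultimately show ?thesis using sl by linarith
  next
    case False
    have "1 = \<rho> powr (s / (2 * b)) * \<rho> powr (- s / (2 * b))" using rho by (simp add: powr_add[symmetric])
    also have "\<dots> \<le> \<rho> powr (s / (2 * b)) * F x" using False by (intro mult_left_mono) auto
    finally have "4 \<le> 4 * \<rho> powr (s / (2 * b)) * F x" by simp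
    moreover have "\<bar>smooth x - u x\<bar> \<le> 4" using smooth_le[of x] u_le[of x] by linarith
    moreover have "0 \<le> \<rho> powr (s / 2)" by simp
    ultimately show ?thesis using nn by linarith
  qed
qed

lemma H_measurable [measurable]: "H \<in> borel_measurable M"
  by (rule continuous_measurable[OF H_continuous])

lemma slope_measurable [measurable]: "slope \<in> borel_measurable M"
  using slope_bound by (intro continuous_measurable) (simp add: local_slope_bound_def)

text \<open>Both the \<open>L^1\<close> bound and the \<open>L^p\<close> bound of
  \<open>slope\<close> come from a pointwise bound by a multiple of \<open>H\<close>; this is their
  common last step.\<close>

lemma integral_H_times:
  assumes K: "(LINT y|M. F y) \<le> K" and c: "0 \<le> c"
    and f: "\<And>x. x \<in> ball x0 r \<Longrightarrow> f x \<le> c * H x"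
  shows "(\<integral>\<^sup>+x\<in>ball x0 r. ennreal (f x) \<partial>M) \<le> ennreal (c * (measure M (ball x0 r) + D * K))"
proof -
  have K0: "0 \<le> K"
    using K F_nonneg by (intro order_trans[OF integral_nonneg_AE K]) auto
  have "(\<integral>\<^sup>+x\<in>ball x0 r. ennreal (f x) \<partial>M) \<le> (\<integral>\<^sup>+x. ennreal c * (ennreal (H x) * indicator (ball x0 r) x) \<partial>M)"
  proof (rule nn_integral_mono)
    fix x
    have "0 \<le> H x" using H_ge_1[of x] by simp
    then show "ennreal (f x) * indicator (ball x0 r) x \<le> ennreal c * (ennreal (H x) * indicator (ball x0 r) x)"
      using f[of x] c by (auto simp: indicator_def ennreal_mult[symmetric] intro!: ennreal_leI)
  qed
  also have "\<dots> = ennreal c * (\<integral>\<^sup>+x\<in>ball x0 r. ennreal (H x) \<partial>M)"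
    by (rule nn_integral_cmult) measurable
  also have "\<dots> \<le> ennreal c * (emeasure M (ball x0 r) + ennreal (D * (LINT y|M. F y)))"
    unfolding H_def by (intro mult_left_mono maxfun_integral F_int F_nonneg R) auto
  also have "\<dots> \<le> ennreal c * (ennreal (measure M (ball x0 r)) + ennreal (D * K))"
    using K D_ge_1 by (intro mult_left_mono add_mono ennreal_leI) (auto simp: ball_emeasure)
  also have "\<dots> = ennreal (c * (measure M (ball x0 r) + D * K))"
    using c K0 D_ge_1 by (subst ennreal_plus[symmetric], simp, simp, subst ennreal_mult[symmetric]) auto
  finally show ?thesis .
qed

lemma integral_smooth_diff:
  assumes K: "(LINT y|M. F y) \<le> K" and \<rho>: "\<rho> \<le> 1"
  shows "(\<integral>\<^sup>+x\<in>ball x0 r. ennreal \<bar>smooth x - u x\<bar> \<partial>M)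
    \<le> ennreal (\<rho> powr (s / 2) * measure M (ball x0 r) + 4 * \<rho> powr (s / (2 * b)) * K)
      + (\<integral>\<^sup>+x\<in>ball x0 r. ennreal (slope x) \<partial>M)"
proof -
  let ?a = "\<rho> powr (s / 2)" and ?e = "4 * \<rho> powr (s / (2 * b))"
  have nn: "0 \<le> slope x" for x using slope_const_pos by (simp add: slope_def)
  have K0: "0 \<le> K"
    using K F_nonneg by (intro order_trans[OF integral_nonneg_AE K]) auto
  have "(\<integral>\<^sup>+x\<in>ball x0 r. ennreal \<bar>smooth x - u x\<bar> \<partial>M)
    \<le> (\<integral>\<^sup>+x. ennreal ?a * indicator (ball x0 r) x + ennreal ?e * ennreal (F x)
        + ennreal (slope x) * indicator (ball x0 r) x \<partial>M)"
  proof (rule nn_integral_mono_AE)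
    show "AE x in M. ennreal \<bar>smooth x - u x\<bar> * indicator (ball x0 r) x
      \<le> ennreal ?a * indicator (ball x0 r) x + ennreal ?e * ennreal (F x)
        + ennreal (slope x) * indicator (ball x0 r) x"
      using AE_not_N
    proof eventually_elim
      case (elim x)
      then show ?case
        using smooth_diff_le[OF elim \<rho>] F_nonneg[of x] nn[of x]
        by (auto simp: indicator_def ennreal_mult[symmetric] ennreal_plus[symmetric]
            simp del: ennreal_plus intro!: ennreal_leI)
    qed
  qed
  also have "\<dots> = ennreal ?a * emeasure M (ball x0 r) + ennreal ?e * (\<integral>\<^sup>+x. ennreal (F x) \<partial>M)
      + (\<integral>\<^sup>+x\<in>ball x0 r. ennreal (slope x) \<partial>M)"
    by (subst nn_integral_add, (simp; fail)+)+ (simp add: nn_integral_cmult nn_integral_cmult_indicator)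
  also have "(\<integral>\<^sup>+x. ennreal (F x) \<partial>M) = ennreal (LINT y|M. F y)"
    using F_int F_nonneg by (intro nn_integral_eq_integral) auto
  also have "ennreal ?a * emeasure M (ball x0 r) + ennreal ?e * ennreal (LINT y|M. F y)
    \<le> ennreal (?a * measure M (ball x0 r)) + ennreal (?e * K)"
    using K K0 by (intro add_mono) (auto simp: ball_emeasure ennreal_mult intro!: mult_left_mono ennreal_leI)
  also have "\<dots> = ennreal (?a * measure M (ball x0 r) + ?e * K)"
    using K0 by (intro ennreal_plus[symmetric]) auto
  finally show ?thesis by (simp add: add_right_mono)
qed

end

section \<open>Approximations with bounded energy and small slope in \<open>L^1\<close>\<close>

lemma powr_power_half_tendsto:
  assumes "0 < a" shows "(\<lambda>k. ((1/2::real) ^ k) powr a) \<longlonglongrightarrow> 0"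
proof -
  have "(\<lambda>k. ((1/2::real) powr a) ^ k) \<longlonglongrightarrow> 0"
    using assms powr_less_mono2[of a "1/2" 1] by (intro LIMSEQ_realpow_zero) auto
  moreover have "((1/2::real) powr a) ^ k = ((1/2::real) ^ k) powr a" for k
    by (simp add: powr_realpow[symmetric] powr_powr mult.commute)
  ultimately show ?thesis by simp
qed

context doubling_space
begin

text \<open>Doubling is used from radius \<open>t\<close> up to radius \<open>2 * r\<close> about
  \<open>x\<close>, where the ball contains \<open>ball x0 r\<close>. The constant depends on
  \<open>ball x0 r\<close>, which is what makes the estimates local.\<close>

lemma ball_lower_bound:
  assumes r: "0 < r"
  obtains c where "0 < c" "\<And>x t. x \<in> ball x0 r \<Longrightarrow> 0 < t \<Longrightarrow> t \<le> r \<Longrightarrow> c * t powr n \<le> measure M (ball x t)"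
proof
  let ?c = "measure M (ball x0 r) / (C\<^sub>1 * (2 * r) powr n)"
  show "0 < ?c" using r C1 ball_pos by simp
  fix x t assume x: "x \<in> ball x0 r" and t: "0 < t" "t \<le> r"
  have "measure M (ball x0 r) \<le> C\<^sub>1 * (2 * r / t) powr n * measure M (ball x t)"
    using x t r by (intro measure_ball_le) (auto simp: dist_commute)
  also have "(2 * r / t) powr n = (2 * r) powr n / t powr n" using r t by (simp add: powr_divide)
  finally show "?c * t powr n \<le> measure M (ball x t)"
    using r t C1 by (simp add: field_simps)
qed

lemma approximation:
  fixes u :: "'a \<Rightarrow> real" and K p s b :: real
  assumes u: "u \<in> borel_measurable M" "\<And>x. \<bar>u x\<bar> \<le> 2" and p: "1 < p" and s: "1 < s"
    and b: "b = 1 / p + (s - 1) / n"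
    and F: "\<And>k::nat. \<exists>F N. integrable M F \<and> (\<forall>x. 0 \<le> F x) \<and> (LINT x|M. F x) \<le> K \<and> N \<in> null_sets M \<and>
      (\<forall>x y. x \<notin> N \<longrightarrow> y \<notin> N \<longrightarrow> dist x y < (1/2) ^ k \<longrightarrow>
        \<bar>u x - u y\<bar> \<le> ((1/2) ^ k) powr s * (F x powr b + F y powr b))"
    and r: "0 < r"
  obtains C\<^sub>0 where "0 \<le> C\<^sub>0"
    "\<And>\<eta>. 0 < \<eta> \<Longrightarrow> \<exists>v h B. local_slope_bound v h \<and> (\<forall>x. \<bar>v x\<bar> \<le> 2) \<and> (\<forall>x\<in>ball x0 r. h x \<le> B) \<and>
      (\<integral>\<^sup>+x\<in>ball x0 r. ennreal (h x powr p) \<partial>M) \<le> ennreal C\<^sub>0 \<and>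
      (\<integral>\<^sup>+x\<in>ball x0 r. ennreal (h x) \<partial>M) \<le> ennreal \<eta> \<and>
      (\<integral>\<^sup>+x\<in>ball x0 r. ennreal \<bar>v x - u x\<bar> \<partial>M) \<le> ennreal \<eta>"
proof -
  obtain c where c: "0 < c" "\<And>x t. x \<in> ball x0 r \<Longrightarrow> 0 < t \<Longrightarrow> t \<le> r \<Longrightarrow> c * t powr n \<le> measure M (ball x t)"
    using ball_lower_bound[OF r] by metis
  have K0: "0 \<le> K"
  proof -
    obtain F where "\<And>x. 0 \<le> F x" "(LINT x|M. F x) \<le> K" using F[of 0] by metis
    then show ?thesis by (intro order_trans[OF integral_nonneg_AE]) auto
  qed
  define A where "A = 1 + K * 8 powr n / c"
  define sc where "sc = 32 * D * (2 * D\<^sup>2) powr b"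
  define Q where "Q = measure M (ball x0 r) + D * K"
  define a where "a = max b 1"
  define \<kappa> where "\<kappa> = s - 1 - n * (a - 1)"
  have A: "0 < A" using K0 c by (simp add: A_def add_pos_nonneg)
  have sc: "0 < sc" using D_ge_1 by (simp add: sc_def)
  have Q: "0 \<le> Q" using K0 D_ge_1 by (simp add: Q_def)
  have b0: "0 < b" unfolding b using p s n by (simp add: add_pos_pos)
  have bp: "b * p - 1 = p * (s - 1) / n" unfolding b using p n by (simp add: field_simps)
  \<comment> \<open>Here both strict inequalities enter: \<open>\<kappa> = s - 1\<close> if
    \<open>b \<le> 1\<close>, and \<open>\<kappa> = n * (1 - 1 / p)\<close> otherwise.\<close>
  have \<kappa>: "0 < \<kappa>"
  proof (cases "b \<le> 1")
    case True then show ?thesis using s by (simp add: \<kappa>_def a_def)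
  next
    case False
    then have "\<kappa> = n * (1 - 1 / p)" using n unfolding \<kappa>_def a_def b by (simp add: field_simps)
    then show ?thesis using n p by simp
  qed
  define C where "C = sc powr p * A powr (b * p - 1) * Q"
  show ?thesis
  proof
    show "0 \<le> C" using Q by (simp add: C_def)
    fix \<eta> :: real assume \<eta>: "0 < \<eta>"
    define e1 where "e1 k = sc * A powr (a - 1) * ((1/2) ^ k) powr \<kappa> * Q" for k :: nat
    define e2 where "e2 k = ((1/2) ^ k) powr (s / 2) * measure M (ball x0 r) + 4 * ((1/2) ^ k) powr (s / (2 * b)) * K" for k :: nat
    have "(\<lambda>k. e2 k + e1 k) \<longlonglongrightarrow> (0 * measure M (ball x0 r) + 4 * 0 * K) + sc * A powr (a - 1) * 0 * Q"
      unfolding e1_def e2_def using s b0 \<kappa>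
      by (intro tendsto_intros powr_power_half_tendsto) auto
    then have ev1: "\<forall>\<^sub>F k in sequentially. e2 k + e1 k < \<eta>" using \<eta> by (auto intro: order_tendstoD)
    have "(\<lambda>k. (1/2::real) ^ k) \<longlonglongrightarrow> 0" by (intro LIMSEQ_realpow_zero) auto
    then have "\<forall>\<^sub>F k in sequentially. (1/2::real) ^ k < 8 * r" using r by (auto intro: order_tendstoD)
    with ev1 have "\<forall>\<^sub>F k in sequentially. e2 k + e1 k < \<eta> \<and> (1/2::real) ^ k < 8 * r"
      by eventually_elim simp
    then obtain k where k: "e2 k + e1 k < \<eta>" "(1/2::real) ^ k < 8 * r"
      using eventually_happens by force
    obtain F N where FN: "integrable M F" "\<And>x. 0 \<le> F x" "(LINT x|M. F x) \<le> K" "N \<in> null_sets M"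
      "\<And>x y. x \<notin> N \<Longrightarrow> y \<notin> N \<Longrightarrow> dist x y < (1/2) ^ k \<Longrightarrow>
        \<bar>u x - u y\<bar> \<le> ((1/2) ^ k) powr s * (F x powr b + F y powr b)"
      using F[of k] by metis
    interpret S: scale_estimate M C\<^sub>1 n u F N "(1/2) ^ k" s b
      by unfold_locales (use u FN b0 in auto)
    have sc_eq: "S.slope_const = sc" by (simp add: S.slope_const_def sc_def)
    have H: "S.H x \<le> A * ((1/2) ^ k) powr - n" if "x \<in> ball x0 r" for x
      unfolding A_def using c(2)[OF that] k FN(3) c(1) by (intro S.H_upper) (auto simp: power_le_one)
    have e1_0: "0 \<le> e1 k" using sc Q by (simp add: e1_def)
    have e2_0: "0 \<le> e2 k" using K0 by (simp add: e2_def)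
    have "(\<integral>\<^sup>+x\<in>ball x0 r. ennreal (S.slope x) \<partial>M) \<le> ennreal (sc * A powr (a - 1) * ((1/2) ^ k) powr \<kappa> * Q)"
      unfolding Q_def
    proof (rule S.integral_H_times[OF FN(3)])
      show "S.slope x \<le> sc * A powr (a - 1) * ((1/2) ^ k) powr \<kappa> * S.H x" if "x \<in> ball x0 r" for x
        using S.slope_le[OF H[OF that], of a] by (simp add: sc_eq \<kappa>_def a_def)
    qed (use sc in auto)
    then have slope1: "(\<integral>\<^sup>+x\<in>ball x0 r. ennreal (S.slope x) \<partial>M) \<le> ennreal (e1 k)"
      by (simp add: e1_def)
    show "\<exists>v h B. local_slope_bound v h \<and> (\<forall>x. \<bar>v x\<bar> \<le> 2) \<and> (\<forall>x\<in>ball x0 r. h x \<le> B) \<and>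
      (\<integral>\<^sup>+x\<in>ball x0 r. ennreal (h x powr p) \<partial>M) \<le> ennreal C \<and>
      (\<integral>\<^sup>+x\<in>ball x0 r. ennreal (h x) \<partial>M) \<le> ennreal \<eta> \<and>
      (\<integral>\<^sup>+x\<in>ball x0 r. ennreal \<bar>v x - u x\<bar> \<partial>M) \<le> ennreal \<eta>"
    \<comment> \<open>The third witness bounds the slope at this scale only and may grow with
      \<open>k\<close>; \<open>cesaro\<close> asks just for some finite bound.\<close>
    proof (rule exI[of _ S.smooth], rule exI[of _ S.slope],
        rule exI[of _ "sc * ((1/2) ^ k) powr (s - 1) * (A * ((1/2) ^ k) powr - n) powr b"], intro conjI ballI allI)
      show "local_slope_bound S.smooth S.slope" by (rule S.slope_bound)
      show "\<bar>S.smooth x\<bar> \<le> 2" for x by (rule S.smooth_le)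
      show "S.slope x \<le> sc * ((1/2) ^ k) powr (s - 1) * (A * ((1/2) ^ k) powr - n) powr b"
        if "x \<in> ball x0 r" for x
        unfolding S.slope_def sc_eq using H[OF that] S.H_ge_1[of x] b0 sc
        by (intro mult_left_mono powr_mono2) auto
      show "(\<integral>\<^sup>+x\<in>ball x0 r. ennreal (S.slope x powr p) \<partial>M) \<le> ennreal C"
        unfolding C_def Q_def
      proof (rule S.integral_H_times[OF FN(3)])
        show "S.slope x powr p \<le> sc powr p * A powr (b * p - 1) * S.H x" if "x \<in> ball x0 r" for x
          using S.slope_power_le[OF H[OF that] _ bp s] p by (simp add: sc_eq)
      qed auto
      show "(\<integral>\<^sup>+x\<in>ball x0 r. ennreal (S.slope x) \<partial>M) \<le> ennreal \<eta>"
        using slope1 k(1) e2_0 by (elim order_trans) (auto intro: ennreal_leI)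
      have "(\<integral>\<^sup>+x\<in>ball x0 r. ennreal \<bar>S.smooth x - u x\<bar> \<partial>M) \<le> ennreal (e2 k) + ennreal (e1 k)"
        unfolding e2_def using slope1
        by (intro order_trans[OF S.integral_smooth_diff[OF FN(3)]] add_left_mono) (auto simp: power_le_one)
      also have "\<dots> \<le> ennreal \<eta>"
        using k(1) e1_0 e2_0 by (simp add: ennreal_plus[symmetric] ennreal_leI del: ennreal_plus)
      finally show "(\<integral>\<^sup>+x\<in>ball x0 r. ennreal \<bar>S.smooth x - u x\<bar> \<partial>M) \<le> ennreal \<eta>" .
    qed
  qed
qed

end

section \<open>Scale-wise gradients\<close>

text \<open>For \<open>c < a\<close>, scaling reduces to \<open>a = 1\<close>, where the convex
  function \<open>t powr p\<close> lies below its chord over \<open>[1, 2]\<close>; otherwise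
  \<open>a + c \<le> 2 * c\<close>. The point is the coefficient 1 of \<open>a powr p\<close>: it
  makes the energies in \<open>cesaro\<close> grow linearly instead of geometrically.\<close>

lemma powr_add_le:
  fixes a c p :: real
  assumes "0 \<le> a" "0 \<le> c" "1 \<le> p"
  shows "(a + c) powr p \<le> a powr p + 2 powr p * a powr (p - 1) * c + 2 powr p * c powr p"
proof (cases "a \<le> c")
  case True
  have "(a + c) powr p \<le> (2 * c) powr p" using True assms by (intro powr_mono2) auto
  also have "\<dots> = 2 powr p * c powr p" by (simp add: powr_mult)
  moreover have "0 \<le> a powr p + 2 powr p * a powr (p - 1) * c" using assms by simp
  ultimately show ?thesis by linarith
next
  case False
  define t where "t = c / a"
  have a: "0 < a" and t: "0 \<le> t" "t \<le> 1" and c: "c = a * t" using False assms by (auto simp: t_def)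
  have "((1 - t) *\<^sub>R 1 + t *\<^sub>R 2) powr p \<le> (1 - t) * 1 powr p + t * 2 powr p"
    using powr_convex[OF assms(3)] t by (intro convex_onD) auto
  then have "(1 + t) powr p \<le> 1 + 2 powr p * t" using t by (simp add: algebra_simps)
  then have "a powr p * (1 + t) powr p \<le> a powr p * (1 + 2 powr p * t)" by (intro mult_left_mono) auto
  also have "\<dots> = a powr p + 2 powr p * a powr (p - 1) * c"
    using a by (simp add: c powr_diff algebra_simps)
  also have "a powr p * (1 + t) powr p = (a + c) powr p"
    by (simp add: c powr_mult[symmetric] distrib_left)
  finally show ?thesis by (smt (verit) mult_nonneg_nonneg powr_ge_zero)
qed

section \<open>Extended powers and the mixed norms\<close>

lemma epowr_mono: "x \<le> y \<Longrightarrow> 0 \<le> a \<Longrightarrow> epowr x a \<le> epowr y a"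
  by (auto simp: epowr_def top.extremum_unique intro!: ennreal_leI powr_mono2 enn2real_mono)
    (auto simp: less_top)

lemma epowr_ennreal: "0 \<le> x \<Longrightarrow> epowr (ennreal x) a = ennreal (x powr a)"
  by (simp add: epowr_def)

lemma epowr_inverse:
  assumes "0 < a" shows "epowr (epowr x a) (1 / a) = x"
  using assms by (cases x) (auto simp: epowr_def powr_powr)

text \<open>One term never exceeds the sum or the supremum. This reduces every \<open>q\<close> to a
  uniform bound on the norms of the single \<open>g k\<close>.\<close>

lemma le_l_norm:
  assumes "0 < q" shows "a k \<le> l_norm q a"
proof (cases "q = \<infinity>")
  case True
  then show ?thesis by (auto simp: l_norm_def intro: SUP_upper)
next
  case False
  then have q: "0 < enn2real q" using assms by (simp add: enn2real_positive_iff less_top)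
  have "epowr (a k) (enn2real q) \<le> (\<integral>\<^sup>+j. epowr (a j) (enn2real q) \<partial>count_space UNIV)"
    by (rule nn_integral_ge_point) auto
  then have "epowr (epowr (a k) (enn2real q)) (1 / enn2real q) \<le> l_norm q a"
    using False q by (auto simp: l_norm_def intro!: epowr_mono)
  then show ?thesis using epowr_inverse[OF q] by simp
qed

lemma L_norm_mono:
  assumes "\<And>x. f x \<le> g x" "0 < \<tau>" shows "L_norm M \<tau> f \<le> L_norm M \<tau> g"
  unfolding L_norm_def using assms by (intro epowr_mono nn_integral_mono) auto

lemma gradient_of_N_space:
  assumes "u \<in> N_space M s \<tau> q" "0 < q"
  obtains g L where "u \<in> borel_measurable M" "g \<in> hajlasz_gradients M s u" "L < \<infinity>"
    "\<And>k. L_norm M \<tau> (\<lambda>x. ennreal (g k x)) \<le> L"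
proof -
  from assms(1) obtain g where g: "g \<in> hajlasz_gradients M s u"
    "l_norm q (\<lambda>k. L_norm M \<tau> (\<lambda>x. ennreal (g k x))) < \<infinity>" and u: "u \<in> borel_measurable M"
    unfolding N_space_def by (auto simp: INF_less_iff)
  show ?thesis by (rule that[OF u g le_l_norm[OF assms(2)]])
qed

lemma gradient_of_M_space:
  assumes "u \<in> M_space M s \<tau> q" "0 < q" "0 < \<tau>"
  obtains g L where "u \<in> borel_measurable M" "g \<in> hajlasz_gradients M s u" "L < \<infinity>"
    "\<And>k. L_norm M \<tau> (\<lambda>x. ennreal (g k x)) \<le> L"
proof -
  from assms(1) obtain g where g: "g \<in> hajlasz_gradients M s u"
    "L_norm M \<tau> (\<lambda>x. l_norm q (\<lambda>k. ennreal (g k x))) < \<infinity>" and u: "u \<in> borel_measurable M"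
    unfolding M_space_def by (auto simp: INF_less_iff)
  have "L_norm M \<tau> (\<lambda>x. ennreal (g k x)) \<le> L_norm M \<tau> (\<lambda>x. l_norm q (\<lambda>k. ennreal (g k x)))" for k
    using le_l_norm[OF assms(2)] assms(3) by (intro L_norm_mono) auto
  then show ?thesis by (rule that[OF u g])
qed

text \<open>The least \<open>j\<close> with \<open>(1/2) ^ j \<le> d\<close> exceeds
  \<open>k\<close>, so \<open>j - 1\<close> is still at least \<open>k\<close>; it is the index of
  the dyadic range that contains \<open>d\<close>.\<close>

lemma dyadic_scale:
  fixes d :: real
  assumes "0 < d" "d < (1/2) ^ k"
  obtains m :: nat where "(1/2) ^ Suc (k + m) \<le> d" "d < (1/2) ^ (k + m)"
proof -
  have ex: "\<exists>j. (1/2) ^ j \<le> d" using real_arch_pow_inv[of d "1/2"] assms by (auto intro: less_imp_le)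
  define j where "j = (LEAST j. (1/2) ^ j \<le> d)"
  have j: "(1/2) ^ j \<le> d" unfolding j_def by (rule LeastI_ex[OF ex])
  have kj: "k < j"
  proof (rule ccontr)
    assume "\<not> k < j"
    then have "(1/2::real) ^ k \<le> (1/2) ^ j" by (intro power_decreasing) auto
    then show False using j assms by linarith
  qed
  have "d < (1/2) ^ (j - 1)"
    using not_less_Least[of "j - 1" "\<lambda>j. (1/2) ^ j \<le> d"] kj by (auto simp: j_def)
  then show ?thesis using that[of "j - 1 - k"] j kj by simp
qed

text \<open>All finer scales are merged into the series \<open>f\<close> of the terms
  \<open>q ^ m * g (int (k + m)) x powr \<tau>\<close>. A pair at distance about
  \<open>2^(-k-m)\<close> gains \<open>2^(-ms)\<close> over scale \<open>k\<close>, and the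
  \<open>\<tau>\<close>-th power of this gain is \<open>q ^ m\<close>. Since only integrals of
  nonnegative functions are added, no triangle inequality in \<open>L^\<tau>\<close> is involved and
  \<open>\<tau> < 1\<close> is harmless.\<close>

lemma scale_gradient:
  fixes u :: "'a::metric_space \<Rightarrow> real"
  assumes sp: "space M = UNIV" and g: "g \<in> hajlasz_gradients M s u" and s: "0 < s" and \<tau>: "0 < \<tau>"
    and J: "0 \<le> J" "\<And>j. (\<integral>\<^sup>+x. ennreal (g j x powr \<tau>) \<partial>M) \<le> ennreal J"
  shows "\<exists>F N. integrable M F \<and> (\<forall>x. 0 \<le> F x) \<and> (LINT x|M. F x) \<le> J / (1 - 2 powr (- (s * \<tau>))) \<and>
    N \<in> null_sets M \<and>
    (\<forall>x y. x \<notin> N \<longrightarrow> y \<notin> N \<longrightarrow> dist x y < (1/2) ^ k \<longrightarrow>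
      \<bar>u x - u y\<bar> \<le> ((1/2) ^ k) powr s * (F x powr (1 / \<tau>) + F y powr (1 / \<tau>)))"
proof -
  from g obtain E where gm [measurable]: "\<And>k. g k \<in> borel_measurable M" and g0: "\<And>k x. 0 \<le> g k x"
    and E: "E \<in> null_sets M" and gE: "\<And>k x y. x \<notin> E \<Longrightarrow> y \<notin> E \<Longrightarrow>
      2 powi (- k - 1) \<le> dist x y \<Longrightarrow> dist x y < 2 powi (- k) \<Longrightarrow>
      \<bar>u x - u y\<bar> \<le> dist x y powr s * (g k x + g k y)"
    by (auto simp: hajlasz_gradients_def)
  define q where "q = 2 powr (- (s * \<tau>))"
  have q: "0 < q" "q < 1" using powr_less_mono[of "- (s * \<tau>)" 0 2] s \<tau> by (auto simp: q_def)
  define f where "f x = (\<Sum>m. ennreal (q ^ m * g (int (k + m)) x powr \<tau>))" for x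
  have fm [measurable]: "f \<in> borel_measurable M" unfolding f_def[abs_def] by measurable
  have "(\<integral>\<^sup>+x. f x \<partial>M) = (\<Sum>m. (\<integral>\<^sup>+x. ennreal (q ^ m * g (int (k + m)) x powr \<tau>) \<partial>M))"
    unfolding f_def by (rule nn_integral_suminf) measurable
  also have "\<dots> \<le> (\<Sum>m. ennreal (q ^ m * J))"
  proof (intro suminf_le)
    fix m
    have "(\<integral>\<^sup>+x. ennreal (q ^ m * g (int (k + m)) x powr \<tau>) \<partial>M)
      = ennreal (q ^ m) * (\<integral>\<^sup>+x. ennreal (g (int (k + m)) x powr \<tau>) \<partial>M)"
      using q by (subst nn_integral_cmult[symmetric]) (auto simp: ennreal_mult)
    also have "\<dots> \<le> ennreal (q ^ m) * ennreal J" using J by (intro mult_left_mono) auto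
    finally show "(\<integral>\<^sup>+x. ennreal (q ^ m * g (int (k + m)) x powr \<tau>) \<partial>M) \<le> ennreal (q ^ m * J)"
      using q J by (simp add: ennreal_mult)
  qed auto
  also have "\<dots> = ennreal (\<Sum>m. q ^ m * J)"
    using q J by (intro suminf_ennreal2 summable_mult2 summable_geometric) auto
  also have "(\<Sum>m. q ^ m * J) = J / (1 - q)"
    using q by (subst suminf_mult2[symmetric]) (auto simp: suminf_geometric intro: summable_geometric)
  finally have int: "(\<integral>\<^sup>+x. f x \<partial>M) \<le> ennreal (J / (1 - q))" .
  \<comment> \<open>\<open>enn2real\<close> sends \<open>\<infinity>\<close> to 0, so the points
    where the series diverges have to be put into \<open>N\<close>.\<close>
  define F where "F x = enn2real (f x)" for x
  define N where "N = E \<union> {x \<in> space M. f x = \<infinity>}"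
  have "AE x in M. f x \<noteq> \<infinity>"
    using int by (intro nn_integral_noteq_infinite) (auto simp: top_unique)
  then have finN: "{x \<in> space M. f x = \<infinity>} \<in> null_sets M"
    by (subst (asm) AE_iff_null) auto
  have nnF: "(\<integral>\<^sup>+x. ennreal (F x) \<partial>M) \<le> ennreal (J / (1 - q))"
    by (rule order_trans[OF nn_integral_mono int]) (auto simp: F_def ennreal_enn2real_if)
  have Fm [measurable]: "F \<in> borel_measurable M" unfolding F_def[abs_def] by measurable
  have Fint: "integrable M F"
    using nnF by (intro integrableI_nonneg) (auto simp: F_def intro: order_le_less_trans)
  have "(LINT x|M. F x) = enn2real (\<integral>\<^sup>+x. ennreal (F x) \<partial>M)"
    by (rule integral_eq_nn_integral) (auto simp: F_def)
  also have "\<dots> \<le> enn2real (ennreal (J / (1 - q)))"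
    using nnF by (intro enn2real_mono) auto
  also have "\<dots> = J / (1 - q)" using J q by simp
  finally have FJ: "(LINT x|M. F x) \<le> J / (1 - q)" .
  have term_le: "(2 powr - s) ^ m * g (int (k + m)) x \<le> F x powr (1 / \<tau>)" if "f x \<noteq> \<infinity>" for m x
  proof -
    have "ennreal (q ^ m * g (int (k + m)) x powr \<tau>) \<le> f x"
      unfolding f_def using sum_le_suminf[of "\<lambda>m. ennreal (q ^ m * g (int (k + m)) x powr \<tau>)" "{m}"] by simp
    also have "f x = ennreal (F x)" using that by (simp add: F_def less_top)
    finally have "q ^ m * g (int (k + m)) x powr \<tau> \<le> F x" by (simp add: F_def)
    then have "(q ^ m * g (int (k + m)) x powr \<tau>) powr (1 / \<tau>) \<le> F x powr (1 / \<tau>)"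
      using q \<tau> by (intro powr_mono2) auto
    moreover have "q ^ m = ((2 powr - s) ^ m) powr \<tau>"
      unfolding q_def by (simp add: powr_realpow[symmetric] powr_powr mult.commute mult.left_commute)
    ultimately show ?thesis
      using \<tau> g0[of "int (k + m)" x] by (simp add: powr_mult powr_powr)
  qed
  show ?thesis
  proof (intro exI[of _ F] exI[of _ N] conjI allI impI)
    show "(LINT x|M. F x) \<le> J / (1 - 2 powr (- (s * \<tau>)))" using FJ by (simp add: q_def)
    show "N \<in> null_sets M" unfolding N_def using E finN by auto
    fix x y assume xy: "x \<notin> N" "y \<notin> N" "dist x y < (1/2) ^ k"
    show "\<bar>u x - u y\<bar> \<le> ((1/2) ^ k) powr s * (F x powr (1 / \<tau>) + F y powr (1 / \<tau>))"
    proof (cases "x = y")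
      case False
      then obtain m :: nat where m: "(1/2) ^ Suc (k + m) \<le> dist x y" "dist x y < (1/2) ^ (k + m)"
        using dyadic_scale[of "dist x y" k] xy by auto
      have pw: "2 powi (- int j) = (1/2::real) ^ j" for j
        by (simp add: power_int_minus power_one_over inverse_eq_divide)
      have "2 powi (- int (k + m) - 1) = (1/2::real) ^ Suc (k + m)" "2 powi (- int (k + m)) = (1/2::real) ^ (k + m)"
      proof -
        have "- int (k + m) - 1 = - int (Suc (k + m))" by simp
        then show "2 powi (- int (k + m) - 1) = (1/2::real) ^ Suc (k + m)" by (simp only: pw)
      qed (rule pw)
      then have "\<bar>u x - u y\<bar> \<le> dist x y powr s * (g (int (k + m)) x + g (int (k + m)) y)"
        using xy m by (intro gE) (auto simp: N_def)
      also have "\<dots> \<le> ((1/2) ^ (k + m)) powr s * (g (int (k + m)) x + g (int (k + m)) y)"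
        using m s g0 by (intro mult_right_mono powr_mono2) (auto intro: add_nonneg_nonneg)
      also have "((1/2) ^ (k + m)) powr s = ((1/2) ^ k) powr s * (2 powr - s) ^ m"
      proof -
        have "((1/2::real) ^ m) powr s = (2 powr - s) ^ m"
          by (simp add: powr_realpow[symmetric] powr_powr powr_minus powr_one_eq_one powr_divide inverse_eq_divide mult.commute)
        then show ?thesis by (simp add: power_add powr_mult)
      qed
      also have "((1/2) ^ k) powr s * (2 powr - s) ^ m * (g (int (k + m)) x + g (int (k + m)) y)
        = ((1/2) ^ k) powr s * ((2 powr - s) ^ m * g (int (k + m)) x + (2 powr - s) ^ m * g (int (k + m)) y)"
        by (simp add: algebra_simps)
      also have "\<dots> \<le> ((1/2) ^ k) powr s * (F x powr (1 / \<tau>) + F y powr (1 / \<tau>))"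
        using xy unfolding N_def
        by (intro mult_left_mono add_mono term_le) (auto simp: sp)
      finally show ?thesis .
    qed simp
  qed (use Fint in \<open>auto simp: F_def\<close>)
qed

section \<open>Means of the approximations and the Poincare inequality\<close>

lemma abs_arctan_diff_le: "\<bar>arctan x - arctan y\<bar> \<le> \<bar>x - y\<bar>"
proof -
  have "norm (arctan x - arctan y) \<le> 1 * norm (x - y)"
  proof (rule field_differentiable_bound[where S = UNIV and f' = "\<lambda>z. inverse (1 + z\<^sup>2)"])
    show "norm (inverse (1 + z\<^sup>2)) \<le> 1" for z :: real
      by (auto simp: inverse_le_1_iff add_nonneg_pos)
  qed (auto intro: DERIV_arctan)
  then show ?thesis by simp
qed

context doubling_space
begin

text \<open>By \<open>powr_add_le\<close>, adding a further \<open>h\<close> to the bounded function \<open>S\<close> increases the integral of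
  \<open>S^p\<close> by a constant only, because the mixed term is controlled by the small \<open>L^1\<close> norm of \<open>h\<close>.
  So the \<open>L^p\<close> norm of \<open>S / m\<close> is of order \<open>m^(1/p - 1)\<close>.\<close>

lemma cesaro:
  fixes u :: "'a \<Rightarrow> real"
  assumes u [measurable]: "u \<in> borel_measurable M" and p: "1 < p" and r: "0 < r" and C: "0 \<le> C"
    and approx: "\<And>\<eta>. 0 < \<eta> \<Longrightarrow> \<exists>v h B. local_slope_bound v h \<and> (\<forall>x. \<bar>v x\<bar> \<le> 2) \<and> (\<forall>x\<in>ball x0 r. h x \<le> B) \<and>
      (\<integral>\<^sup>+x\<in>ball x0 r. ennreal (h x powr p) \<partial>M) \<le> ennreal C \<and>
      (\<integral>\<^sup>+x\<in>ball x0 r. ennreal (h x) \<partial>M) \<le> ennreal \<eta> \<and>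
      (\<integral>\<^sup>+x\<in>ball x0 r. ennreal \<bar>v x - u x\<bar> \<partial>M) \<le> ennreal \<eta>"
    and \<eta>: "0 < \<eta>"
  shows "\<exists>V S B. local_slope_bound V S \<and> (\<forall>x. \<bar>V x\<bar> \<le> 2 * real m) \<and> (\<forall>x\<in>ball x0 r. S x \<le> B) \<and>
      (\<integral>\<^sup>+x\<in>ball x0 r. ennreal (S x powr p) \<partial>M) \<le> ennreal (real m * (1 + 2 powr p * C)) \<and>
      (\<integral>\<^sup>+x\<in>ball x0 r. ennreal \<bar>V x - real m * u x\<bar> \<partial>M) \<le> ennreal (real m * \<eta>)"
proof (induction m)
  case 0
  show ?case
    using p by (intro exI[of _ "\<lambda>_. 0"] exI[of _ 0] exI[of _ "0::real"]) (auto simp: local_slope_bound_def intro: exI[of _ "1::real"])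
next
  case (Suc m)
  let ?B = "ball x0 r"
  obtain V S B where V: "local_slope_bound V S" "\<And>x. \<bar>V x\<bar> \<le> 2 * real m" "\<And>x. x \<in> ?B \<Longrightarrow> S x \<le> B"
      "(\<integral>\<^sup>+x\<in>?B. ennreal (S x powr p) \<partial>M) \<le> ennreal (real m * (1 + 2 powr p * C))"
      "(\<integral>\<^sup>+x\<in>?B. ennreal \<bar>V x - real m * u x\<bar> \<partial>M) \<le> ennreal (real m * \<eta>)"
    using Suc.IH by blast
  define c where "c = 2 powr p * B powr (p - 1)"
  have c: "0 \<le> c" by (simp add: c_def)
  \<comment> \<open>The new pair is chosen after \<open>S\<close>: with \<open>S \<le> B\<close> on
    the ball, the mixed term of \<open>powr_add_le\<close> is at most \<open>c * h\<close>, and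
    \<open>\<theta>\<close> makes its integral at most 1.\<close>
  define \<theta> where "\<theta> = min \<eta> (1 / (c + 1))"
  have \<theta>: "0 < \<theta>" "\<theta> \<le> \<eta>" "c * \<theta> \<le> 1"
  proof -
    show "0 < \<theta>" using c \<eta> by (simp add: \<theta>_def add_nonneg_pos)
    have "c * \<theta> \<le> c * (1 / (c + 1))" unfolding \<theta>_def using c by (intro mult_left_mono) auto
    also have "\<dots> \<le> 1" using c by simp
    finally show "c * \<theta> \<le> 1" .
  qed (simp add: \<theta>_def)
  obtain v h K where v: "local_slope_bound v h" "\<And>x. \<bar>v x\<bar> \<le> 2" "\<And>x. x \<in> ?B \<Longrightarrow> h x \<le> K"
      "(\<integral>\<^sup>+x\<in>?B. ennreal (h x powr p) \<partial>M) \<le> ennreal C"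
      "(\<integral>\<^sup>+x\<in>?B. ennreal (h x) \<partial>M) \<le> ennreal \<theta>"
      "(\<integral>\<^sup>+x\<in>?B. ennreal \<bar>v x - u x\<bar> \<partial>M) \<le> ennreal \<theta>"
    using approx[OF \<theta>(1)] by blast
  have S0: "0 \<le> S x" and h0: "0 \<le> h x" for x using V(1) v(1) by (auto simp: local_slope_bound_def)
  have [measurable]: "S \<in> borel_measurable M" "h \<in> borel_measurable M"
    using V(1) v(1) by (auto simp: local_slope_bound_def intro: continuous_measurable)
  have [measurable]: "V \<in> borel_measurable M" "v \<in> borel_measurable M"
    using V(1) v(1) by (auto intro: continuous_measurable local_slope_bound_continuous)
  show ?case
  proof (rule exI[of _ "\<lambda>x. V x + v x"], rule exI[of _ "\<lambda>x. S x + h x"], rule exI[of _ "B + K"],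
      intro conjI allI ballI)
    show "local_slope_bound (\<lambda>x. V x + v x) (\<lambda>x. S x + h x)" using V(1) v(1) by (rule local_slope_bound_add)
    show "\<bar>V x + v x\<bar> \<le> 2 * real (Suc m)" for x
      using V(2)[of x] v(2)[of x] by simp
    show "S x + h x \<le> B + K" if "x \<in> ?B" for x using V(3) v(3) that by (simp add: add_mono)
    have "(\<integral>\<^sup>+x\<in>?B. ennreal ((S x + h x) powr p) \<partial>M)
      \<le> (\<integral>\<^sup>+x. ennreal (S x powr p) * indicator ?B x + ennreal c * (ennreal (h x) * indicator ?B x)
          + ennreal (2 powr p) * (ennreal (h x powr p) * indicator ?B x) \<partial>M)"
    proof (rule nn_integral_mono)
      fix x
      show "ennreal ((S x + h x) powr p) * indicator ?B x
        \<le> ennreal (S x powr p) * indicator ?B x + ennreal c * (ennreal (h x) * indicator ?B x)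
          + ennreal (2 powr p) * (ennreal (h x powr p) * indicator ?B x)"
      proof (cases "x \<in> ?B")
        case True
        have "(S x + h x) powr p \<le> S x powr p + 2 powr p * S x powr (p - 1) * h x + 2 powr p * h x powr p"
          using S0 h0 p by (intro powr_add_le) auto
        also have "\<dots> \<le> S x powr p + c * h x + 2 powr p * h x powr p"
          unfolding c_def using S0 h0 p V(3)[OF True]
          by (intro add_mono mult_right_mono mult_left_mono powr_mono2) auto
        finally show ?thesis using True c h0
          by (simp add: ennreal_mult[symmetric] ennreal_plus[symmetric] ennreal_leI del: ennreal_plus)
      qed simp
    qed
    also have "\<dots> = (\<integral>\<^sup>+x\<in>?B. ennreal (S x powr p) \<partial>M) + ennreal c * (\<integral>\<^sup>+x\<in>?B. ennreal (h x) \<partial>M)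
      + ennreal (2 powr p) * (\<integral>\<^sup>+x\<in>?B. ennreal (h x powr p) \<partial>M)"
      by (simp add: nn_integral_add nn_integral_cmult)
    also have "\<dots> \<le> ennreal (real m * (1 + 2 powr p * C)) + ennreal c * ennreal \<theta> + ennreal (2 powr p) * ennreal C"
      using V(4) v(4,5) by (intro add_mono mult_left_mono) auto
    also have "\<dots> = ennreal (real m * (1 + 2 powr p * C) + c * \<theta> + 2 powr p * C)"
      using c \<theta> C by (simp add: ennreal_mult[symmetric] ennreal_plus[symmetric] del: ennreal_plus)
    also have "\<dots> \<le> ennreal (real (Suc m) * (1 + 2 powr p * C))"
      using \<theta> by (intro ennreal_leI) (simp add: algebra_simps)
    finally show "(\<integral>\<^sup>+x\<in>?B. ennreal ((S x + h x) powr p) \<partial>M) \<le> ennreal (real (Suc m) * (1 + 2 powr p * C))" .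
    have "(\<integral>\<^sup>+x\<in>?B. ennreal \<bar>V x + v x - real (Suc m) * u x\<bar> \<partial>M)
      \<le> (\<integral>\<^sup>+x. ennreal \<bar>V x - real m * u x\<bar> * indicator ?B x + ennreal \<bar>v x - u x\<bar> * indicator ?B x \<partial>M)"
    proof (rule nn_integral_mono)
      fix x
      have "\<bar>V x + v x - real (Suc m) * u x\<bar> \<le> \<bar>V x - real m * u x\<bar> + \<bar>v x - u x\<bar>"
        by (simp add: algebra_simps)
      then show "ennreal \<bar>V x + v x - real (Suc m) * u x\<bar> * indicator ?B x
        \<le> ennreal \<bar>V x - real m * u x\<bar> * indicator ?B x + ennreal \<bar>v x - u x\<bar> * indicator ?B x"
        by (auto simp: indicator_def ennreal_plus[symmetric] ennreal_leI simp del: ennreal_plus)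
    qed
    also have "\<dots> = (\<integral>\<^sup>+x\<in>?B. ennreal \<bar>V x - real m * u x\<bar> \<partial>M) + (\<integral>\<^sup>+x\<in>?B. ennreal \<bar>v x - u x\<bar> \<partial>M)"
      by (rule nn_integral_add) measurable
    also have "\<dots> \<le> ennreal (real m * \<eta>) + ennreal \<theta>" using V(5) v(6) by (rule add_mono)
    also have "\<dots> \<le> ennreal (real (Suc m) * \<eta>)"
      using \<theta> \<eta> by (simp add: ennreal_plus[symmetric] ennreal_leI algebra_simps del: ennreal_plus)
    finally show "(\<integral>\<^sup>+x\<in>?B. ennreal \<bar>V x + v x - real (Suc m) * u x\<bar> \<partial>M) \<le> ennreal (real (Suc m) * \<eta>)" .
  qed
qed

section \<open>From small oscillation to constancy\<close>

lemma set_integral_abs_le: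
  assumes "f \<in> borel_measurable M" "\<And>x. \<bar>f x\<bar> \<le> c"
  shows "ennreal (LINT x:ball x0 r|M. \<bar>f x\<bar>) = (\<integral>\<^sup>+x\<in>ball x0 r. ennreal \<bar>f x\<bar> \<partial>M)"
proof -
  have "locally_integrable (\<lambda>x. \<bar>f x\<bar>)"
    using assms by (intro locally_integrable_bounded[where c = c]) auto
  then have "integrable M (\<lambda>x. indicator (ball x0 r) x *\<^sub>R \<bar>f x\<bar>)"
    by (simp add: locally_integrable_def set_integrable_def)
  then have "ennreal (LINT x:ball x0 r|M. \<bar>f x\<bar>) = (\<integral>\<^sup>+x. ennreal (indicator (ball x0 r) x *\<^sub>R \<bar>f x\<bar>) \<partial>M)"
    unfolding set_lebesgue_integral_def by (intro nn_integral_eq_integral[symmetric]) auto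
  also have "\<dots> = (\<integral>\<^sup>+x\<in>ball x0 r. ennreal \<bar>f x\<bar> \<partial>M)"
    by (intro nn_integral_cong) (auto simp: indicator_def)
  finally show ?thesis .
qed

text \<open>The approximating constant \<open>c\<close> varies with \<open>\<eta>\<close>, while the
  mean \<open>a\<close> is fixed. As \<open>\<bar>a - c\<bar> * \<mu>\<close> is at most the
  integral of \<open>\<bar>u - c\<bar>\<close>, replacing \<open>c\<close> by \<open>a\<close> at
  most doubles the error, and \<open>\<eta>\<close> can then tend to 0.\<close>

lemma constant_on_ball:
  assumes u [measurable]: "u \<in> borel_measurable M" and ule: "\<And>x. \<bar>u x\<bar> \<le> 2"
    and near: "\<And>\<eta>. 0 < \<eta> \<Longrightarrow> \<exists>c. (\<integral>\<^sup>+x\<in>ball x0 r. ennreal \<bar>u x - c\<bar> \<partial>M) \<le> ennreal \<eta>"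
    and r: "0 < r"
  shows "\<exists>c. AE x in M. x \<in> ball x0 r \<longrightarrow> u x = c"
proof -
  let ?B = "ball x0 r"
  define \<mu> where "\<mu> = measure M ?B"
  have \<mu>: "0 < \<mu>" using ball_pos[OF r] by (simp add: \<mu>_def)
  define a where "a = (LINT x:?B|M. u x) / \<mu>"
  have small: "(\<integral>\<^sup>+x\<in>?B. ennreal \<bar>u x - a\<bar> \<partial>M) \<le> ennreal \<eta>" if \<eta>: "0 < \<eta>" for \<eta>
  proof -
    obtain c where c: "(\<integral>\<^sup>+x\<in>?B. ennreal \<bar>u x - c\<bar> \<partial>M) \<le> ennreal (\<eta> / 2)"
      using near[of "\<eta> / 2"] \<eta> by auto
    have bd: "\<bar>u x - c\<bar> \<le> 2 + \<bar>c\<bar>" for x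
      using abs_triangle_ineq4[of "u x" c] ule[of x] by linarith
    have "ennreal (LINT x:?B|M. \<bar>u x - c\<bar>) \<le> ennreal (\<eta> / 2)"
      using c set_integral_abs_le[of "\<lambda>x. u x - c" "2 + \<bar>c\<bar>" x0 r] bd by simp
    then have I: "(LINT x:?B|M. \<bar>u x - c\<bar>) \<le> \<eta> / 2" using \<eta> by simp
    have si: "set_integrable M ?B u" "set_integrable M ?B (\<lambda>_. c)"
      using locally_integrable_bounded[OF u ule] locally_integrable_bounded[of "\<lambda>_. c" "\<bar>c\<bar>"]
      by (auto simp: locally_integrable_def)
    have c_int: "(LINT x:?B|M. c) = c * \<mu>"
      by (simp add: \<mu>_def set_lebesgue_integral_def)
    have "(LINT x:?B|M. u x - c) = (LINT x:?B|M. u x) - c * \<mu>"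
      using set_integral_diff(2)[OF si] by (simp add: c_int)
    also have "\<dots> = (a - c) * \<mu>" using \<mu> by (simp add: a_def left_diff_distrib)
    finally have "\<bar>a - c\<bar> * \<mu> = \<bar>LINT x:?B|M. u x - c\<bar>" using \<mu> by (simp add: abs_mult)
    also have "\<dots> \<le> (LINT x:?B|M. \<bar>u x - c\<bar>)"
      using integral_norm_bound[of M "\<lambda>x. indicator ?B x *\<^sub>R (u x - c)"]
      by (simp add: set_lebesgue_integral_def abs_mult)
    finally have ac: "\<bar>a - c\<bar> * \<mu> \<le> \<eta> / 2" using I by simp
    have "(\<integral>\<^sup>+x\<in>?B. ennreal \<bar>u x - a\<bar> \<partial>M)
      \<le> (\<integral>\<^sup>+x. ennreal \<bar>u x - c\<bar> * indicator ?B x + ennreal \<bar>a - c\<bar> * indicator ?B x \<partial>M)"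
      by (intro nn_integral_mono)
        (auto simp: indicator_def ennreal_plus[symmetric] simp del: ennreal_plus intro!: ennreal_leI)
    also have "\<dots> = (\<integral>\<^sup>+x\<in>?B. ennreal \<bar>u x - c\<bar> \<partial>M) + ennreal \<bar>a - c\<bar> * emeasure M ?B"
      by (subst nn_integral_add) (auto simp: nn_integral_cmult_indicator)
    also have "\<dots> \<le> ennreal (\<eta> / 2) + ennreal (\<eta> / 2)"
      using c ac by (intro add_mono) (auto simp: ball_emeasure \<mu>_def ennreal_mult[symmetric] intro!: ennreal_leI)
    also have "\<dots> = ennreal \<eta>" using \<eta> by (subst ennreal_plus[symmetric]) auto
    finally show ?thesis .
  qed
  have "(\<integral>\<^sup>+x\<in>?B. ennreal \<bar>u x - a\<bar> \<partial>M) \<le> 0"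
  proof (rule ennreal_le_epsilon)
    fix e :: real assume "0 < e"
    then show "(\<integral>\<^sup>+x\<in>?B. ennreal \<bar>u x - a\<bar> \<partial>M) \<le> 0 + ennreal e"
      using small[of e] by (simp only: add_0)
  qed
  then have "(\<integral>\<^sup>+x\<in>?B. ennreal \<bar>u x - a\<bar> \<partial>M) = 0" by simp
  then have "AE x in M. ennreal \<bar>u x - a\<bar> * indicator ?B x = 0"
    by (subst (asm) nn_integral_0_iff_AE) auto
  then have "AE x in M. x \<in> ?B \<longrightarrow> u x = a"
    by eventually_elim (auto simp: indicator_def split: if_splits)
  then show ?thesis by blast
qed

text \<open>Concentric balls of radius \<open>Suc k\<close> all contain the unit ball, whose
  positive measure forces their constants to agree.\<close>

lemma constant_of_balls:
  assumes ball: "\<And>x0 r. 0 < r \<Longrightarrow> \<exists>c. AE x in M. x \<in> ball x0 r \<longrightarrow> u x = c"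
  shows "\<exists>c. AE x in M. u x = c"
proof -
  fix x0
  have "\<exists>c. AE x in M. x \<in> ball x0 (Suc k) \<longrightarrow> u x = c" for k :: nat by (rule ball) simp
  then obtain c where c: "\<And>k. AE x in M. x \<in> ball x0 (Suc k) \<longrightarrow> u x = c k" by metis
  have const: "c k = c 0" for k
  proof (rule ccontr)
    assume ne: "c k \<noteq> c 0"
    have eq: "{x \<in> space M. \<not> x \<notin> ball x0 1} = ball x0 1" by (simp add: ball_def)
    have "AE x in M. x \<notin> ball x0 1"
      using c[of k] c[of 0] by eventually_elim (use ne in auto)
    then have "emeasure M (ball x0 1) = 0"
      using AE_iff_measurable[OF ball_sets eq] by blast
    then show False using ball_pos[of 1 x0] by (simp add: measure_def)
  qed
  have "AE x in M. x \<in> ball x0 (Suc k) \<longrightarrow> u x = c 0" for k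
    using c[of k] unfolding const[of k] .
  then have "AE x in M. \<forall>k. x \<in> ball x0 (Suc k) \<longrightarrow> u x = c 0"
    unfolding AE_all_countable by blast
  then have "AE x in M. u x = c 0"
  proof eventually_elim
    case (elim x)
    obtain k :: nat where "dist x0 x < real k" using reals_Archimedean2 by blast
    then have "x \<in> ball x0 (Suc k)" by simp
    then show ?case using elim by blast
  qed
  then show ?thesis by blast
qed

lemma poincare_constant:
  assumes poincare: "supports_poincare M p" and p: "1 < p" and s: "1 < s"
    and b: "b = 1 / p + (s - 1) / n"
    and u [measurable]: "u \<in> borel_measurable M" and ule: "\<And>x. \<bar>u x\<bar> \<le> 2"
    and F: "\<And>k::nat. \<exists>F N. integrable M F \<and> (\<forall>x. 0 \<le> F x) \<and> (LINT x|M. F x) \<le> K \<and> N \<in> null_sets M \<and>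
      (\<forall>x y. x \<notin> N \<longrightarrow> y \<notin> N \<longrightarrow> dist x y < (1/2) ^ k \<longrightarrow>
        \<bar>u x - u y\<bar> \<le> ((1/2) ^ k) powr s * (F x powr b + F y powr b))"
  shows "\<exists>c. AE x in M. u x = c"
proof (rule constant_of_balls)
  fix x0 :: 'a and r :: real assume r: "0 < r"
  obtain C l where C: "0 < C" and l: "1 < l" and all: "\<forall>u g.
      (\<forall>x. \<forall>r>0. set_integrable M (ball x r) u) \<longrightarrow> weak_upper_gradient M p u g \<longrightarrow>
      (\<forall>x. \<forall>r>0.
        ennreal (average M (ball x r) (\<lambda>y. \<bar>u y - average M (ball x r) u\<bar>))
          \<le> ennreal (C * r) * epowr (average_nn M (ball x (l * r)) (\<lambda>y. ennreal (g y powr p))) (1 / p))"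
    using poincare unfolding supports_poincare_def by (elim exE conjE) (rule that)
  let ?B = "ball x0 r" and ?B' = "ball x0 (l * r)"
  have lr: "0 < l * r" using l r by simp
  define \<mu> \<mu>' where "\<mu> = measure M ?B" and "\<mu>' = measure M ?B'"
  have \<mu>: "0 < \<mu>" "0 < \<mu>'" using ball_pos[OF r] ball_pos[OF lr] by (auto simp: \<mu>_def \<mu>'_def)
  \<comment> \<open>The approximation is taken on the enlarged ball, over which the right-hand side
    of the Poincare inequality is averaged.\<close>
  obtain C\<^sub>0 where C0: "0 \<le> C\<^sub>0" and approx:
    "\<And>\<eta>. 0 < \<eta> \<Longrightarrow> \<exists>v h B. local_slope_bound v h \<and> (\<forall>x. \<bar>v x\<bar> \<le> 2) \<and> (\<forall>x\<in>?B'. h x \<le> B) \<and>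
      (\<integral>\<^sup>+x\<in>?B'. ennreal (h x powr p) \<partial>M) \<le> ennreal C\<^sub>0 \<and>
      (\<integral>\<^sup>+x\<in>?B'. ennreal (h x) \<partial>M) \<le> ennreal \<eta> \<and>
      (\<integral>\<^sup>+x\<in>?B'. ennreal \<bar>v x - u x\<bar> \<partial>M) \<le> ennreal \<eta>"
    by (rule approximation[OF u ule p s b F lr, of x0]) (rule that, assumption, blast)
  define Q where "Q = 1 + 2 powr p * C\<^sub>0"
  have Q: "0 \<le> Q" using C0 by (simp add: Q_def)
  show "\<exists>c. AE x in M. x \<in> ?B \<longrightarrow> u x = c"
  proof (rule constant_on_ball[OF u ule _ r])
    fix \<eta> :: real assume \<eta>: "0 < \<eta>"
    \<comment> \<open>For the mean of \<open>Suc m\<close> pairs, \<open>cesaro\<close> bounds the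
      integral of \<open>g^p\<close> by \<open>(Suc m)^(-p) * Suc m * Q\<close>. The Poincare
      inequality turns this into \<open>\<delta> m\<close>, which tends to 0 because
      \<open>p > 1\<close>. The other half of \<open>\<eta>\<close> is left for the distance between
      the mean and \<open>u\<close>.\<close>
    define \<delta> where "\<delta> m = C * r * (real (Suc m) powr (1 - p) * Q / \<mu>') powr (1 / p) * \<mu>" for m
    have "(\<lambda>m. real (Suc m) powr (1 - p)) \<longlonglongrightarrow> 0"
      using p by (intro tendsto_neg_powr filterlim_compose[OF filterlim_real_sequentially filterlim_Suc]) auto
    then have "(\<lambda>m. (real (Suc m) powr (1 - p) * Q / \<mu>')) \<longlonglongrightarrow> 0 * Q / \<mu>'"
      using \<mu> by (intro tendsto_intros) auto
    then have "(\<lambda>m. (real (Suc m) powr (1 - p) * Q / \<mu>') powr (1 / p)) \<longlonglongrightarrow> 0"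
      using p Q \<mu> by (intro tendsto_zero_powrI[where b = "1 / p"]) auto
    then have "\<delta> \<longlonglongrightarrow> C * r * 0 * \<mu>" unfolding \<delta>_def by (intro tendsto_intros)
    then have "\<delta> \<longlonglongrightarrow> 0" by simp
    then have "\<forall>\<^sub>F m in sequentially. \<delta> m < \<eta> / 2" by (rule order_tendstoD) (use \<eta> in simp)
    then obtain k where k: "\<delta> k < \<eta> / 2" using eventually_happens by force
    define m where "m = Suc k"
    have m: "0 < real m" by (simp add: m_def)
    obtain V S B where V: "local_slope_bound V S" "\<And>x. \<bar>V x\<bar> \<le> 2 * real m"
      "(\<integral>\<^sup>+x\<in>?B'. ennreal (S x powr p) \<partial>M) \<le> ennreal (real m * Q)"
      "(\<integral>\<^sup>+x\<in>?B'. ennreal \<bar>V x - real m * u x\<bar> \<partial>M) \<le> ennreal (real m * (\<eta> / 2))"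
      using cesaro[OF u p lr C0 approx, of "\<eta> / 2" m] \<eta> unfolding Q_def by auto
    define v g where "v = (\<lambda>x. 1 / real m * V x)" and "g = (\<lambda>x. 1 / real m * S x)"
    have vg: "local_slope_bound v g" unfolding v_def g_def using V(1) by (intro local_slope_bound_scale) auto
    have S0: "0 \<le> S x" for x using V(1) by (auto simp: local_slope_bound_def)
    have [measurable]: "S \<in> borel_measurable M"
      using V(1) by (auto simp: local_slope_bound_def intro: continuous_measurable)
    have [measurable]: "V \<in> borel_measurable M" "v \<in> borel_measurable M"
      using V(1) vg by (auto intro: continuous_measurable local_slope_bound_continuous)
    have vle: "\<bar>v x\<bar> \<le> 2" for x using V(2)[of x] m by (simp add: v_def abs_mult field_simps)
    define c where "c = average M ?B v"
    have vc: "\<bar>v x - c\<bar> \<le> 2 + \<bar>c\<bar>" for x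
      using abs_triangle_ineq4[of "v x" c] vle[of x] by linarith
    have "average_nn M ?B' (\<lambda>y. ennreal (g y powr p)) \<le> ennreal (real m powr (1 - p) * Q / \<mu>')"
    proof -
      have "(\<integral>\<^sup>+x\<in>?B'. ennreal (g x powr p) \<partial>M) = (\<integral>\<^sup>+x. ennreal (real m powr - p) * (ennreal (S x powr p) * indicator ?B' x) \<partial>M)"
      proof (rule nn_integral_cong)
        fix x
        have "g x powr p = real m powr - p * S x powr p"
          using m S0 by (simp add: g_def powr_divide powr_minus field_simps)
        then show "ennreal (g x powr p) * indicator ?B' x = ennreal (real m powr - p) * (ennreal (S x powr p) * indicator ?B' x)"
          by (simp add: ennreal_mult mult.assoc)
      qed
      also have "\<dots> = ennreal (real m powr - p) * (\<integral>\<^sup>+x\<in>?B'. ennreal (S x powr p) \<partial>M)"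
        by (rule nn_integral_cmult) measurable
      also have "\<dots> \<le> ennreal (real m powr - p) * ennreal (real m * Q)" using V(3) by (rule mult_left_mono) simp
      also have "\<dots> = ennreal (real m powr (1 - p) * Q)"
        using m Q by (simp add: ennreal_mult[symmetric] powr_diff powr_minus field_simps)
      finally have "(\<integral>\<^sup>+x\<in>?B'. ennreal (g x powr p) \<partial>M) \<le> ennreal (real m powr (1 - p) * Q)" .
      then have "average_nn M ?B' (\<lambda>y. ennreal (g y powr p)) \<le> ennreal (real m powr (1 - p) * Q) / ennreal \<mu>'"
        unfolding average_nn_def \<mu>'_def by (subst ball_emeasure) (rule divide_right_mono_ennreal)
      also have "\<dots> = ennreal (real m powr (1 - p) * Q / \<mu>')" using \<mu> Q by (intro divide_ennreal) auto
      finally show ?thesis .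
    qed
    then have "epowr (average_nn M ?B' (\<lambda>y. ennreal (g y powr p))) (1 / p)
      \<le> ennreal ((real m powr (1 - p) * Q / \<mu>') powr (1 / p))"
      using epowr_mono[of _ "ennreal (real m powr (1 - p) * Q / \<mu>')" "1 / p"] p Q \<mu> by (simp add: epowr_ennreal)
    moreover have "ennreal (average M ?B (\<lambda>y. \<bar>v y - c\<bar>))
        \<le> ennreal (C * r) * epowr (average_nn M ?B' (\<lambda>y. ennreal (g y powr p))) (1 / p)"
      unfolding c_def
    proof (rule all[THEN spec, THEN spec, THEN mp, THEN mp, THEN spec, THEN spec, THEN mp])
      show "\<forall>x. \<forall>r>0. set_integrable M (ball x r) v"
        using locally_integrable_bounded[of v 2] vle by (auto simp: locally_integrable_def)
    qed (rule local_slope_bound_weak_upper_gradient[OF vg], rule r)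
    ultimately have "ennreal (average M ?B (\<lambda>y. \<bar>v y - c\<bar>))
        \<le> ennreal (C * r) * ennreal ((real m powr (1 - p) * Q / \<mu>') powr (1 / p))"
      by (meson mult_left_mono order_trans zero_le)
    also have "\<dots> = ennreal (C * r * (real m powr (1 - p) * Q / \<mu>') powr (1 / p))"
      using C r by (simp add: ennreal_mult)
    finally have "average M ?B (\<lambda>y. \<bar>v y - c\<bar>) \<le> C * r * (real m powr (1 - p) * Q / \<mu>') powr (1 / p)"
      using C r by (subst (asm) ennreal_le_iff) auto
    then have "(LINT y:?B|M. \<bar>v y - c\<bar>) \<le> \<delta> k"
      using \<mu> unfolding average_def \<delta>_def m_def \<mu>_def[symmetric] by (simp add: pos_divide_le_eq)
    then have "ennreal (LINT y:?B|M. \<bar>v y - c\<bar>) \<le> ennreal (\<eta> / 2)" using k by (intro ennreal_leI) simp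
    then have vI: "(\<integral>\<^sup>+x\<in>?B. ennreal \<bar>v x - c\<bar> \<partial>M) \<le> ennreal (\<eta> / 2)"
      using set_integral_abs_le[of "\<lambda>x. v x - c" "2 + \<bar>c\<bar>" x0 r] vc by simp
    have uI: "(\<integral>\<^sup>+x\<in>?B. ennreal \<bar>v x - u x\<bar> \<partial>M) \<le> ennreal (\<eta> / 2)"
    proof -
      have "(\<integral>\<^sup>+x\<in>?B. ennreal \<bar>v x - u x\<bar> \<partial>M)
        \<le> (\<integral>\<^sup>+x. ennreal (1 / real m) * (ennreal \<bar>V x - real m * u x\<bar> * indicator ?B' x) \<partial>M)"
      proof (rule nn_integral_mono)
        fix x
        have "\<bar>v x - u x\<bar> = 1 / real m * \<bar>V x - real m * u x\<bar>"
        proof -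
          have "v x - u x = 1 / real m * (V x - real m * u x)" using m by (simp add: v_def field_simps)
          then show ?thesis using m by (simp add: abs_mult)
        qed
        then have "ennreal \<bar>v x - u x\<bar> = ennreal (1 / real m) * ennreal \<bar>V x - real m * u x\<bar>"
          using m ennreal_mult[of "1 / real m" "\<bar>V x - real m * u x\<bar>"] by simp
        moreover have "x \<in> ?B'" if "x \<in> ?B"
        proof -
          have "dist x0 x < r" using that by simp
          also have "r \<le> l * r" using mult_right_mono[of 1 l r] l r by linarith
          finally show ?thesis by simp
        qed
        ultimately show "ennreal \<bar>v x - u x\<bar> * indicator ?B x
          \<le> ennreal (1 / real m) * (ennreal \<bar>V x - real m * u x\<bar> * indicator ?B' x)"
          by (auto simp: indicator_def)
      qed
      also have "\<dots> = ennreal (1 / real m) * (\<integral>\<^sup>+x\<in>?B'. ennreal \<bar>V x - real m * u x\<bar> \<partial>M)"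
        by (rule nn_integral_cmult) measurable
      also have "\<dots> \<le> ennreal (1 / real m) * ennreal (real m * (\<eta> / 2))" using V(4) by (rule mult_left_mono) simp
      also have "\<dots> = ennreal (\<eta> / 2)" using m \<eta> by (simp add: ennreal_mult[symmetric])
      finally show ?thesis .
    qed
    have "(\<integral>\<^sup>+x\<in>?B. ennreal \<bar>u x - c\<bar> \<partial>M)
      \<le> (\<integral>\<^sup>+x. ennreal \<bar>v x - u x\<bar> * indicator ?B x + ennreal \<bar>v x - c\<bar> * indicator ?B x \<partial>M)"
      by (intro nn_integral_mono)
        (auto simp: indicator_def ennreal_plus[symmetric] simp del: ennreal_plus intro!: ennreal_leI)
    also have "\<dots> = (\<integral>\<^sup>+x\<in>?B. ennreal \<bar>v x - u x\<bar> \<partial>M) + (\<integral>\<^sup>+x\<in>?B. ennreal \<bar>v x - c\<bar> \<partial>M)"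
      by (rule nn_integral_add) measurable
    also have "\<dots> \<le> ennreal (\<eta> / 2) + ennreal (\<eta> / 2)" using uI vI by (rule add_mono)
    also have "\<dots> = ennreal \<eta>" using \<eta> by (subst ennreal_plus[symmetric]) auto
    finally show "\<exists>c. (\<integral>\<^sup>+x\<in>?B. ennreal \<bar>u x - c\<bar> \<partial>M) \<le> ennreal \<eta>" by blast
  qed
qed

section \<open>Application to fractional gradients\<close>

lemma hajlasz_constant:
  assumes poincare: "supports_poincare M p" and p: "1 < p" and s: "1 < s"
    and \<tau>: "\<tau> = n * p / (n + p * s - p)"
    and u: "u \<in> borel_measurable M" and g: "g \<in> hajlasz_gradients M s u"
    and L: "L < \<infinity>" "\<And>k. L_norm M \<tau> (\<lambda>x. ennreal (g k x)) \<le> L"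
  shows "\<exists>c. AE x in M. u x = c"
proof -
  have "0 < n + p * (s - 1)" using n p s by (simp add: add_pos_pos)
  then have den: "0 < n + p * s - p" by (simp add: algebra_simps)
  have \<tau>0: "0 < \<tau>" unfolding \<tau> using n p den by simp
  have b: "1 / \<tau> = 1 / p + (s - 1) / n" unfolding \<tau> using n p den by (simp add: field_simps)
  \<comment> \<open>A merely measurable \<open>u\<close> becomes bounded, hence locally integrable.
    As \<open>arctan\<close> is 1-Lipschitz, \<open>g\<close> remains a gradient sequence of
    \<open>w\<close>, and \<open>tan\<close> recovers \<open>u\<close> at the end.\<close>
  define w where "w x = arctan (u x)" for x
  have w: "w \<in> borel_measurable M" unfolding w_def[abs_def] using u
    by (intro borel_measurable_continuous_on[of arctan] continuous_intros) auto
  have wle: "\<bar>w x\<bar> \<le> 2" for x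
    using arctan_bounded[of "u x"] pi_less_4 unfolding w_def abs_le_iff by linarith
  have le: "\<bar>w x - w y\<bar> \<le> \<bar>u x - u y\<bar>" for x y unfolding w_def by (rule abs_arctan_diff_le)
  have gw: "g \<in> hajlasz_gradients M s w"
    using g unfolding hajlasz_gradients_def by (blast intro: order_trans[OF le])
  have g0: "0 \<le> g k x" for k x using g by (simp add: hajlasz_gradients_def)
  define J where "J = enn2real (epowr L \<tau>)"
  have J: "(\<integral>\<^sup>+x. ennreal (g j x powr \<tau>) \<partial>M) \<le> ennreal J" for j
  proof -
    have "(\<integral>\<^sup>+x. ennreal (g j x powr \<tau>) \<partial>M) = (\<integral>\<^sup>+x. epowr (ennreal (g j x)) \<tau> \<partial>M)"
      using g0 by (simp add: epowr_ennreal)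
    also have "\<dots> = epowr (L_norm M \<tau> (\<lambda>x. ennreal (g j x))) \<tau>"
      unfolding L_norm_def using epowr_inverse[of "1 / \<tau>"] \<tau>0 by simp
    also have "\<dots> \<le> epowr L \<tau>" using L \<tau>0 by (intro epowr_mono) auto
    also have "\<dots> = ennreal J" using L(1) by (simp add: J_def epowr_def)
    finally show ?thesis .
  qed
  have "0 < s" "0 \<le> J" using s by (auto simp: J_def)
  then have "\<exists>c. AE x in M. w x = c"
    by (rule poincare_constant[OF poincare p s b w wle scale_gradient[OF space_M gw _ \<tau>0 _ J]])
  then obtain c where c: "AE x in M. w x = c" ..
  then have "AE x in M. u x = tan c" by eventually_elim (auto simp: w_def tan_arctan)
  then show ?thesis by blast
qed

end

theorem theorem4p2:
  fixes M :: "'a::metric_space measure" and C\<^sub>1 n p s \<tau> :: real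
  assumes "doubling_metric_measure_space M C\<^sub>1 n"
    and "1 < p"
    and "supports_poincare M p"
    and "1 < s"
    and "\<tau> = n * p / (n + p * s - p)"
  shows "(\<forall>q::ennreal. 0 < q \<longrightarrow> trivial_space M (M_space M s \<tau> q)) \<and>
         (\<forall>q::ennreal. 0 < q \<and> q \<le> ennreal \<tau> \<longrightarrow> trivial_space M (N_space M s \<tau> q)) \<and>
         (complete (UNIV :: 'a set) \<or> (\<exists>\<epsilon>. 0 < \<epsilon> \<and> \<epsilon> < p - 1 \<and> supports_poincare M (p - \<epsilon>)) \<longrightarrow>
            (\<forall>q::ennreal. ennreal \<tau> < q \<longrightarrow> trivial_space M (N_space M s \<tau> q)))"
proof -
  interpret doubling_space M C\<^sub>1 n by unfold_locales (rule assms(1))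
  have "0 < n + p * (s - 1)" using n assms by (simp add: add_pos_pos)
  then have \<tau>0: "0 < \<tau>" unfolding assms(5) using n assms by (simp add: algebra_simps)
  note const = hajlasz_constant[OF assms(3,2,4,5)]
  have "trivial_space M (M_space M s \<tau> q)" if "0 < q" for q
    unfolding trivial_space_def
  proof
    fix u assume "u \<in> M_space M s \<tau> q"
    then show "\<exists>c. AE x in M. u x = c"
      by (rule gradient_of_M_space[OF _ that \<tau>0]) (rule const)
  qed
  moreover have "trivial_space M (N_space M s \<tau> q)" if "0 < q" for q
    unfolding trivial_space_def
  proof
    fix u assume "u \<in> N_space M s \<tau> q"
    then show "\<exists>c. AE x in M. u x = c"
      by (rule gradient_of_N_space[OF _ that]) (rule const)
  qed
  moreover have "0 < q" if "ennreal \<tau> < q" for q using that by (rule order_le_less_trans[OF zero_le])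
  ultimately show ?thesis by blast
qed

end
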